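(* Let $G$ be a locally compact second countable amenable group acting continuously on a compact metric space $X$, let $\mu$ be a $G$-invariant Borel probability measure on $X$, and fix a tempered Følner sequence $(F_n)$ in $G$. Suppose that $(X,G,\mu)$ is minimal, uniquely ergodic, mixing of all orders, has minimal self-joinings of all orders, and has no weakly asymptotic pairs. Moreover, assume that for every $N\ge1$ every point $(x_1,\dots,x_N)\in X^{\times N}$ is generic for some ergodic measure of the system $(X^{\times N},\{g^{\times N}\}_{g\in G})$. Then $(X,G)$ is IC-rigid.
   Context: Let $m$ be Haar measure on $G$, $e$ its identity, $Z(G)$ its center, $d_X$ the metric on $X$. Write $g^{\times N}(x_1,\dots,x_N)=(gx_1,\dots,gx_N)$. **Minimal / uniquely ergodic:** every orbit is dense / there is exactly one $G$-invariant Borel probability measure on $X$. **Mixing of all orders:** for every $N\ge1$ and Borel $A_0,\dots,A_N\subset X$, $\mu(g_0A_0\cap\dots\cap g_NA_N)\to\mu(A_0)\cdots\mu(A_N)$ as $g_i^{-1}g_j\to\infty$ for all $i\neq j$. **Joinings.** An $N$-fold self-joining is a $\{g^{\times N}\}_{g\in G}$-invariant Borel probability measure on $X^{\times N}$ with all one-coordinate marginals equal to $\mu$. Let ${}^N\Delta(A_1\times\dots\times A_N)=\mu(A_1\cap\dots\cap A_N)$, and for $\mathbf{g}=(g_1,\dots,g_N)\in G^N$ let ${}^N\Delta^{\mathbf g}=(g_1\times\dots\times g_N)_*{}^N\Delta$; it is called off-diagonal if $g_i^{-1}g_j\in Z(G)$ for all $i,j$. A self-joining is trivial if, possibly after permuting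 coordinates, it is a direct product of off-diagonal joinings (including the one-fold joining $\mu$). The system has minimal self-joinings of all orders if for every $N\ge2$ every $N$-fold self-joining that is ergodic for $(X^{\times N},\{g^{\times N}\}_{g\in G})$ is trivial. **Generic point.** $p\in X^{\times N}$ is generic for $\nu$ if $\frac1{m(F_n)}\int_{F_n}\delta_{g^{\times N}p}\,dm(g)\to\nu$ weakly$^*$. **Weakly asymptotic pair.** For $D\subset G$ let $\bar d(D)=\limsup_n m(F_n\cap D)/m(F_n)$. Points $x\ne y$ of $X$ form a weakly asymptotic pair if there is $D\subset G$ with $\bar d(D)>0$ such that $d_X(gx,gy)\to0$ as $g\to\infty$ along $D$. **IC-rigidity.** $\mathcal{K}(Y)$ is the set of nonempty compact subsets of $Y$; $\mathcal{K}(X)$ carries the Hausdorff metric; $\mathcal{K}_{\mathrm{fin}}(X)$ is the set of nonempty finite subsets. Put $\mathcal{K}_G(X)=\{\bigcup_{x\in K}\{gx:g\in I_x\}:K\in\mathcal{K}_{\mathrm{fin}}(X),\ I_x\in\mathcal{K}(Z(G))\ \forall x\in K\}$. $G$ acts on $\mathcal{K}(X)$ by $gK=\{gx:x\in K\}$. $(X,G)$ is IC-rigid if every $G$-invariant Borel probability measure $\nu$ on $\mathcal{K}(X)$ satisfies $\nu(\mathcal{K}_G(X)\cup\{X\})=1$, where $\{X\}$ is the one-element subset of $\mathcal{K}(X)$ whose element is $X$. *)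

theory Defs
  imports "HOL-Probability.Probability"
begin

section \<open>The acting group\<close>

text \<open>
  Groups are written additively, but are not assumed commutative: the class
  \<^class>\<open>topological_group_add\<close> extends \<^class>\<open>group_add\<close>.  Thus the product of \<open>g\<close> and \<open>h\<close> is
  \<open>g + h\<close>, the identity is \<open>0\<close>, and the element usually written as \<open>g\<close> inverse times \<open>h\<close>
  is \<open>- g + h\<close>.
\<close>

definition group_center :: "'g::group_add set" where
  "group_center = {z. \<forall>g. z + g = g + z}"

text \<open>
  Left Haar measure.  Regularity is not listed, because on a locally compact second countable
  Hausdorff space it follows from finiteness on compact sets.
\<close>

definition left_haar_measure :: "'g::topological_group_add measure \<Rightarrow> bool" where
  "left_haar_measure m \<longleftrightarrow>
     sets m = sets borel \<and>
     (\<forall>g. \<forall>A\<in>sets borel. emeasure m ((\<lambda>h. g + h) ` A) = emeasure m A) \<and>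
     (\<forall>K. compact K \<longrightarrow> emeasure m K < \<infinity>) \<and>
     (\<forall>U. open U \<longrightarrow> U \<noteq> {} \<longrightarrow> emeasure m U > 0)"

text \<open>
  Amenability, by the existence of arbitrarily invariant compact sets.  The set \<open>K\<close> has to be
  nonempty: for empty \<open>K\<close> the symmetric difference below is \<open>F\<close> itself.
\<close>

definition amenable_group :: "'g::topological_group_add measure \<Rightarrow> bool" where
  "amenable_group m \<longleftrightarrow>
     (\<forall>K \<epsilon>. compact K \<longrightarrow> K \<noteq> {} \<longrightarrow> \<epsilon> > 0 \<longrightarrow>
        (\<exists>F. compact F \<and> measure m F > 0 \<and>
             measure m (sym_diff F {k + f | k f. k \<in> K \<and> f \<in> F}) < \<epsilon> * measure m F))"

definition folner_sequence :: "'g::topological_group_add measure \<Rightarrow> (nat \<Rightarrow> 'g set) \<Rightarrow> bool" where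
  "folner_sequence m F \<longleftrightarrow>
     (\<forall>n. compact (F n) \<and> measure m (F n) > 0) \<and>
     (\<forall>g. (\<lambda>n. measure m (sym_diff ((\<lambda>h. g + h) ` F n) (F n)) / measure m (F n)) \<longlonglongrightarrow> 0)"

definition tempered :: "'g::topological_group_add measure \<Rightarrow> (nat \<Rightarrow> 'g set) \<Rightarrow> bool" where
  "tempered m F \<longleftrightarrow>
     (\<exists>C>0. \<forall>n. measure m (\<Union>k<n. {- h + f | h f. h \<in> F k \<and> f \<in> F n}) \<le> C * measure m (F n))"

definition upper_density :: "'g measure \<Rightarrow> (nat \<Rightarrow> 'g set) \<Rightarrow> 'g set \<Rightarrow> ereal" where
  "upper_density m F D = limsup (\<lambda>n. ereal (measure m (F n \<inter> D) / measure m (F n)))"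


section \<open>Actions and invariant measures\<close>

text \<open>
  A compact metric space is rendered as a type \<open>'x\<close> of class \<^class>\<open>polish_space\<close> with compact
  universe.  This is no restriction, since compact metric spaces are complete and second countable.
\<close>

definition continuous_action ::
    "('g::topological_group_add \<Rightarrow> 'x::topological_space \<Rightarrow> 'x) \<Rightarrow> bool" where
  "continuous_action act \<longleftrightarrow>
     (\<forall>x. act 0 x = x) \<and>
     (\<forall>g h x. act (g + h) x = act g (act h x)) \<and>
     continuous_on UNIV (\<lambda>(g, x). act g x)"

definition minimal_action :: "('g \<Rightarrow> 'x::topological_space \<Rightarrow> 'x) \<Rightarrow> bool" where
  "minimal_action act \<longleftrightarrow> (\<forall>x. closure (range (\<lambda>g. act g x)) = UNIV)"

text \<open>
  In the following two definitions only the measurable space underlying \<open>S\<close> matters, and \<open>T\<close> is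
  an action on it by measurable maps.
\<close>

definition invariant_prob :: "'y measure \<Rightarrow> ('g \<Rightarrow> 'y \<Rightarrow> 'y) \<Rightarrow> 'y measure \<Rightarrow> bool" where
  "invariant_prob S T \<nu> \<longleftrightarrow>
     prob_space \<nu> \<and> sets \<nu> = sets S \<and> (\<forall>g. distr \<nu> S (T g) = \<nu>)"

definition ergodic_prob :: "'y measure \<Rightarrow> ('g \<Rightarrow> 'y \<Rightarrow> 'y) \<Rightarrow> 'y measure \<Rightarrow> bool" where
  "ergodic_prob S T \<nu> \<longleftrightarrow>
     invariant_prob S T \<nu> \<and>
     (\<forall>A\<in>sets S. (\<forall>g. measure \<nu> (sym_diff (T g -` A \<inter> space S) A) = 0) \<longrightarrow>
        measure \<nu> A = 0 \<or> measure \<nu> A = 1)"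

definition uniquely_ergodic :: "('g \<Rightarrow> 'x::topological_space \<Rightarrow> 'x) \<Rightarrow> bool" where
  "uniquely_ergodic act \<longleftrightarrow> (\<exists>!\<nu>. invariant_prob borel act \<nu>)"

text \<open>
  Convergence of all the elements \<open>- g i + g j\<close> to infinity means that they eventually leave
  every compact set.
\<close>

definition mixing_of_all_orders ::
    "('g::topological_group_add \<Rightarrow> 'x::topological_space \<Rightarrow> 'x) \<Rightarrow> 'x measure \<Rightarrow> bool" where
  "mixing_of_all_orders act \<mu> \<longleftrightarrow>
     (\<forall>N\<ge>1. \<forall>A :: nat \<Rightarrow> 'x set. (\<forall>i\<le>N. A i \<in> sets borel) \<longrightarrow>
        (\<forall>\<epsilon>>0. \<exists>K. compact K \<and>
          (\<forall>g :: nat \<Rightarrow> 'g. (\<forall>i\<le>N. \<forall>j\<le>N. i \<noteq> j \<longrightarrow> - g i + g j \<notin> K) \<longrightarrow>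
            \<bar>measure \<mu> (\<Inter>i\<le>N. act (g i) ` A i) - (\<Prod>i\<le>N. measure \<mu> (A i))\<bar> < \<epsilon>)))"


section \<open>Self-joinings\<close>

text \<open>
  The power of \<open>X\<close> with finite index set \<open>I\<close> consists of the extensional functions on \<open>I\<close>; the
  \<open>N\<close>-fold power has index set \<open>{..<N}\<close>.  For second countable \<open>X\<close> the product \<open>\<sigma>\<close>-algebra is
  the Borel \<open>\<sigma>\<close>-algebra of the product topology.
\<close>

abbreviation power_borel :: "nat set \<Rightarrow> (nat \<Rightarrow> 'x::topological_space) measure" where
  "power_borel I \<equiv> PiM I (\<lambda>_. borel)"

definition power_act :: "nat set \<Rightarrow> ('g \<Rightarrow> 'x \<Rightarrow> 'x) \<Rightarrow> 'g \<Rightarrow> (nat \<Rightarrow> 'x) \<Rightarrow> (nat \<Rightarrow> 'x)" where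
  "power_act I act g p = (\<lambda>i\<in>I. act g (p i))"

definition self_joining ::
    "('g \<Rightarrow> 'x::topological_space \<Rightarrow> 'x) \<Rightarrow> 'x measure \<Rightarrow> nat \<Rightarrow> (nat \<Rightarrow> 'x) measure \<Rightarrow> bool" where
  "self_joining act \<mu> N \<nu> \<longleftrightarrow>
     invariant_prob (power_borel {..<N}) (power_act {..<N} act) \<nu> \<and>
     (\<forall>i<N. distr \<nu> borel (\<lambda>p. p i) = \<mu>)"

definition diagonal_joining ::
    "'x::topological_space measure \<Rightarrow> nat set \<Rightarrow> (nat \<Rightarrow> 'x) measure" where
  "diagonal_joining \<mu> I = distr \<mu> (power_borel I) (\<lambda>x. \<lambda>i\<in>I. x)"

lemma emeasure_diagonal_joining:
  assumes "finite I" "I \<noteq> {}" "sets \<mu> = sets borel" "\<And>i. i \<in> I \<Longrightarrow> A i \<in> sets borel"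
  shows "emeasure (diagonal_joining \<mu> I) (PiE I A) = emeasure \<mu> (\<Inter>i\<in>I. A i)"
proof -
  have sp: "space \<mu> = UNIV"
    using sets_eq_imp_space_eq[OF assms(3)] by simp
  have "(\<lambda>x. \<lambda>i\<in>I. x) \<in> measurable \<mu> (power_borel I)"
    by (rule measurable_restrict) (simp add: measurable_ident_sets assms(3))
  moreover have "PiE I A \<in> sets (power_borel I)"
    using assms by (intro sets_PiM_I_finite) auto
  ultimately have "emeasure (diagonal_joining \<mu> I) (PiE I A)
      = emeasure \<mu> ((\<lambda>x. \<lambda>i\<in>I. x) -` PiE I A \<inter> space \<mu>)"
    unfolding diagonal_joining_def by (rule emeasure_distr)
  also have "(\<lambda>x. \<lambda>i\<in>I. x) -` PiE I A \<inter> space \<mu> = (\<Inter>i\<in>I. A i)"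
    using assms(2) by (auto simp: sp PiE_iff)
  finally show ?thesis .
qed

definition translated_diagonal ::
    "('g \<Rightarrow> 'x::topological_space \<Rightarrow> 'x) \<Rightarrow> 'x measure \<Rightarrow> nat set \<Rightarrow> (nat \<Rightarrow> 'g) \<Rightarrow> (nat \<Rightarrow> 'x) measure"
  where
  "translated_diagonal act \<mu> I \<gamma> =
     distr (diagonal_joining \<mu> I) (power_borel I) (\<lambda>p. \<lambda>i\<in>I. act (\<gamma> i) (p i))"

definition off_diagonal_joining ::
    "('g::group_add \<Rightarrow> 'x::topological_space \<Rightarrow> 'x) \<Rightarrow> 'x measure \<Rightarrow> nat set \<Rightarrow> (nat \<Rightarrow> 'x) measure \<Rightarrow> bool"
  where
  "off_diagonal_joining act \<mu> I \<rho> \<longleftrightarrow>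
     (\<exists>\<gamma>. (\<forall>i\<in>I. \<forall>j\<in>I. - \<gamma> i + \<gamma> j \<in> group_center) \<and> \<rho> = translated_diagonal act \<mu> I \<gamma>)"

text \<open>
  The direct product of measures \<open>\<rho> B\<close> on the powers with index sets \<open>B \<in> P\<close>, where \<open>P\<close> is a
  partition of \<open>{..<N}\<close>, moved to the power with index set \<open>{..<N}\<close>.  As the blocks of \<open>P\<close> need
  not be intervals, this accounts for the permutation of coordinates in the definition of
  triviality.
\<close>

definition direct_product ::
    "nat \<Rightarrow> nat set set \<Rightarrow> (nat set \<Rightarrow> (nat \<Rightarrow> 'x::topological_space) measure) \<Rightarrow> (nat \<Rightarrow> 'x) measure"
  where
  "direct_product N P \<rho> =
     distr (PiM P \<rho>) (power_borel {..<N}) (\<lambda>\<omega>. \<lambda>i\<in>{..<N}. \<omega> (THE B. B \<in> P \<and> i \<in> B) i)"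

definition trivial_joining ::
    "('g::group_add \<Rightarrow> 'x::topological_space \<Rightarrow> 'x) \<Rightarrow> 'x measure \<Rightarrow> nat \<Rightarrow> (nat \<Rightarrow> 'x) measure \<Rightarrow> bool"
  where
  "trivial_joining act \<mu> N \<nu> \<longleftrightarrow>
     (\<exists>P \<rho>. partition_on {..<N} P \<and> (\<forall>B\<in>P. off_diagonal_joining act \<mu> B (\<rho> B)) \<and>
            \<nu> = direct_product N P \<rho>)"

definition minimal_self_joinings_of_all_orders ::
    "('g::group_add \<Rightarrow> 'x::topological_space \<Rightarrow> 'x) \<Rightarrow> 'x measure \<Rightarrow> bool" where
  "minimal_self_joinings_of_all_orders act \<mu> \<longleftrightarrow>
     (\<forall>N\<ge>2. \<forall>\<nu>. self_joining act \<mu> N \<nu> \<longrightarrow>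
        ergodic_prob (power_borel {..<N}) (power_act {..<N} act) \<nu> \<longrightarrow>
        trivial_joining act \<mu> N \<nu>)"


section \<open>Generic points and weakly asymptotic pairs\<close>

text \<open>The weak* convergence is tested on all continuous functions on the (compact) power.\<close>

definition generic_point ::
    "'g measure \<Rightarrow> (nat \<Rightarrow> 'g set) \<Rightarrow> ('g \<Rightarrow> 'x::topological_space \<Rightarrow> 'x) \<Rightarrow> nat \<Rightarrow>
      (nat \<Rightarrow> 'x) measure \<Rightarrow> (nat \<Rightarrow> 'x) \<Rightarrow> bool" where
  "generic_point m F act N \<nu> p \<longleftrightarrow>
     (\<forall>f. continuous_map (product_topology (\<lambda>_. euclidean) {..<N}) euclideanreal f \<longrightarrow>
        (\<lambda>n. (LINT g:F n|m. f (power_act {..<N} act g p)) / measure m (F n))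
          \<longlonglongrightarrow> (LINT q|\<nu>. f q))"

definition weakly_asymptotic_pair ::
    "'g::topological_group_add measure \<Rightarrow> (nat \<Rightarrow> 'g set) \<Rightarrow> ('g \<Rightarrow> 'x::metric_space \<Rightarrow> 'x) \<Rightarrow>
      'x \<Rightarrow> 'x \<Rightarrow> bool" where
  "weakly_asymptotic_pair m F act x y \<longleftrightarrow>
     x \<noteq> y \<and>
     (\<exists>D\<in>sets borel. upper_density m F D > 0 \<and>
        (\<forall>\<epsilon>>0. \<exists>K. compact K \<and> (\<forall>g\<in>D - K. dist (act g x) (act g y) < \<epsilon>)))"


section \<open>The hyperspace and IC-rigidity\<close>

definition nonempty_compacts :: "'x::topological_space set set" where
  "nonempty_compacts = {K. compact K \<and> K \<noteq> {}}"

text \<open>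
  The value \<open>0\<close> outside \<^const>\<open>nonempty_compacts\<close> is there because \<^locale>\<open>Metric_space\<close> asks for
  a distance that is nonnegative and symmetric on the whole type.
\<close>

definition hausdorff_distance :: "'x::metric_space set \<Rightarrow> 'x set \<Rightarrow> real" where
  "hausdorff_distance A B =
     (if A \<in> nonempty_compacts \<and> B \<in> nonempty_compacts
      then max (SUP x\<in>A. infdist x B) (SUP y\<in>B. infdist y A) else 0)"

lemma hausdorff_distance_le_iff:
  fixes A B :: "'x::metric_space set"
  assumes "A \<in> nonempty_compacts" "B \<in> nonempty_compacts"
  shows "hausdorff_distance A B \<le> r \<longleftrightarrow> (\<forall>x\<in>A. infdist x B \<le> r) \<and> (\<forall>y\<in>B. infdist y A \<le> r)"
proof -
  have bdd: "bdd_above ((\<lambda>x. infdist x B) ` A)" if "compact A" for A B :: "'x set"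
    by (intro bounded_imp_bdd_above compact_imp_bounded compact_continuous_image
        continuous_on_infdist continuous_on_id that)
  show ?thesis
    using assms by (auto simp: hausdorff_distance_def nonempty_compacts_def cSUP_le_iff bdd)
qed

lemma Metric_space_hausdorff:
  "Metric_space (nonempty_compacts :: 'x::metric_space set set) hausdorff_distance"
proof
  fix A B :: "'x set"
  show "hausdorff_distance A B = hausdorff_distance B A"
    by (simp add: hausdorff_distance_def max.commute conj_commute)
  show nn: "0 \<le> hausdorff_distance A B"
  proof (cases "A \<in> nonempty_compacts \<and> B \<in> nonempty_compacts")
    case True
    then obtain x where "x \<in> A" by (auto simp: nonempty_compacts_def)
    then have "infdist x B \<le> hausdorff_distance A B"
      using True hausdorff_distance_le_iff[of A B "hausdorff_distance A B"] by auto
    then show ?thesis using infdist_nonneg[of x B] by linarith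
  qed (auto simp: hausdorff_distance_def)
  assume A: "A \<in> nonempty_compacts" and B: "B \<in> nonempty_compacts"
  have "hausdorff_distance A B = 0 \<longleftrightarrow> hausdorff_distance A B \<le> 0"
    using nn by linarith
  also have "\<dots> \<longleftrightarrow> (\<forall>x\<in>A. infdist x B = 0) \<and> (\<forall>y\<in>B. infdist y A = 0)"
    using A B by (simp add: hausdorff_distance_le_iff order.eq_iff infdist_nonneg)
  also have "\<dots> \<longleftrightarrow> (\<forall>x\<in>A. x \<in> B) \<and> (\<forall>y\<in>B. y \<in> A)"
    using A B by (simp add: nonempty_compacts_def compact_imp_closed
        in_closed_iff_infdist_zero[symmetric])
  finally show "hausdorff_distance A B = 0 \<longleftrightarrow> A = B" by blast
next
  fix A B C :: "'x set"
  assume *: "A \<in> nonempty_compacts" "B \<in> nonempty_compacts" "C \<in> nonempty_compacts"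
  have tri: "infdist x C \<le> hausdorff_distance A B + hausdorff_distance B C"
    if "x \<in> A" "A \<in> nonempty_compacts" "B \<in> nonempty_compacts" "C \<in> nonempty_compacts"
    for x and A B C :: "'x set"
  proof -
    have "compact B" "B \<noteq> {}" "continuous_on B (dist x)"
      using that by (auto simp: nonempty_compacts_def intro!: continuous_intros)
    then obtain y where y: "y \<in> B" "\<And>z. z \<in> B \<Longrightarrow> dist x y \<le> dist x z"
      using continuous_attains_inf[of B "dist x"] by blast
    have "dist x y \<le> infdist x B"
      using y \<open>B \<noteq> {}\<close> by (auto simp: infdist_def intro: cINF_greatest)
    also have "\<dots> \<le> hausdorff_distance A B"
      using that hausdorff_distance_le_iff[of A B "hausdorff_distance A B"] by auto
    finally have xy: "dist x y \<le> hausdorff_distance A B" .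
    have "infdist x C \<le> infdist y C + dist x y" by (rule infdist_triangle)
    moreover have "infdist y C \<le> hausdorff_distance B C"
      using that y hausdorff_distance_le_iff[of B C "hausdorff_distance B C"] by auto
    ultimately show ?thesis using xy by linarith
  qed
  have comm: "hausdorff_distance A B = hausdorff_distance B A" for A B :: "'x set"
    by (simp add: hausdorff_distance_def max.commute conj_commute)
  show "hausdorff_distance A C \<le> hausdorff_distance A B + hausdorff_distance B C"
    using * tri[of _ A B C] tri[of _ C B A] comm[of A B] comm[of B C]
    by (auto simp: hausdorff_distance_le_iff add.commute)
qed

definition hyperspace_borel :: "'x::metric_space set measure" where
  "hyperspace_borel =
     sigma nonempty_compacts
       {U. openin (Metric_space.mtopology nonempty_compacts hausdorff_distance) U}"

definition central_orbit_compacts ::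
    "('g::topological_group_add \<Rightarrow> 'x \<Rightarrow> 'x) \<Rightarrow> 'x set set" where
  "central_orbit_compacts act =
     {(\<Union>x\<in>K. (\<lambda>g. act g x) ` I x) | K I.
        finite K \<and> K \<noteq> {} \<and> (\<forall>x\<in>K. compact (I x) \<and> I x \<noteq> {} \<and> I x \<subseteq> group_center)}"

definition ic_rigid :: "('g::topological_group_add \<Rightarrow> 'x::metric_space \<Rightarrow> 'x) \<Rightarrow> bool" where
  "ic_rigid act \<longleftrightarrow>
     (\<forall>\<nu>. invariant_prob hyperspace_borel (\<lambda>g K. act g ` K) \<nu> \<longrightarrow>
        measure \<nu> (central_orbit_compacts act \<union> {UNIV}) = 1)"

end

theory Submission
  imports Defs
begin

text \<open>
  A \<open>G\<close>-invariant random compact set is shown to be almost surely either the whole space or a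
  finite union of compact pieces of orbits of the center.

  The starting point is a reformulation of the second alternative
  (\<open>not_central_orbit_compacts_iff\<close>): a compact set \<open>K\<close> fails it if and only if, for every compact
  subset \<open>C\<close> of the center and every \<open>n\<close>, it contains \<open>n\<close> points none of which is the translate of
  another by an element of \<open>C\<close>.  This is a countable intersection of open conditions, so the
  alternative is Borel, and it is invariant under \<open>G\<close>.

  Take such a \<open>K\<close> and a ball \<open>V\<close>.  The density of the set of \<open>g\<close> for which \<open>g K\<close> misses \<open>V\<close> is zero
  (\<open>density_missing_ball\<close>).  Indeed, \<open>N\<close> well separated points of \<open>K\<close> form a point of the power that
  is generic for an ergodic measure; by unique ergodicity this measure is a self-joining, and by
  assumption it is a product of off-diagonal joinings.  Two coordinates in one block are linked by
  a central element \<open>z\<close>.  As there are no weakly asymptotic pairs, \<open>z\<close> then maps the one point to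
  the other (\<open>generic_measure_PiE_le\<close>, based on \<open>weakly_asymptotic_pairI\<close>), so by separation it is
  far out in the center.  Mixing of all orders
  makes such an off-diagonal block look like a product (\<open>mixing_block\<close>).  Altogether the frequency
  of the \<open>g\<close> that keep all \<open>N\<close> points outside \<open>V\<close> is at most about the \<open>N\<close>-th power of a number less
  than one, and \<open>N\<close> is arbitrary.

  For an invariant measure \<open>\<kappa>\<close> on the hyperspace, the set of these \<open>K\<close> that miss \<open>V\<close> has the same
  measure as its translates.  Averaging over \<open>F n\<close> and exchanging the integrals shows that this
  measure is zero (\<open>null_missing_open\<close>).  Letting \<open>V\<close> run through countably many balls, almost every
  such \<open>K\<close> is dense, hence equal to the whole space.
\<close>

section \<open>The center, and compact subsets of the group\<close>

lemma closed_group_center: "closed (group_center :: 'g::{topological_group_add, t2_space} set)"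
proof -
  have eq: "group_center = (\<Inter>g::'g. {z. z + g = g + z})"
    by (auto simp: group_center_def)
  show ?thesis
    unfolding eq by (intro closed_INT ballI closed_Collect_eq continuous_intros)
qed

lemma minus_mem_group_center:
  assumes "z \<in> group_center"
  shows "- z \<in> group_center"
proof -
  have "- z + g = g + - z" for g
  proof -
    have "z + (g + - z) = (g + z) + - z"
      using assms by (simp add: group_center_def add.assoc[symmetric])
    also have "\<dots> = z + (- z + g)"
      by (simp add: add.assoc)
    finally show ?thesis
      by (metis add_left_imp_eq)
  qed
  then show ?thesis
    by (simp add: group_center_def)
qed

lemma add_mem_group_center:
  assumes "y \<in> group_center" "z \<in> group_center"
  shows "y + z \<in> group_center"
proof -
  have "y + z + g = g + (y + z)" for g
    using assms unfolding group_center_def by (metis (mono_tags, lifting) add.assoc mem_Collect_eq)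
  then show ?thesis
    by (simp add: group_center_def)
qed

lemma zero_mem_group_center: "0 \<in> group_center"
  by (simp add: group_center_def)

text \<open>
  Cofinality among all compact sets, not merely a covering of the space, is what reduces the
  uncountably many separation conditions on a compact set to countably many.
\<close>

lemma compact_exhaustion:
  assumes "locally_compact_space (euclidean :: 'a::{t2_space, second_countable_topology} topology)"
  shows "\<exists>C :: nat \<Rightarrow> 'a::{t2_space, second_countable_topology} set. (\<forall>k. compact (C k)) \<and> (\<forall>K. compact K \<longrightarrow> (\<exists>k. K \<subseteq> C k))"
proof -
  have "\<exists>U K. open U \<and> compact K \<and> x \<in> U \<and> U \<subseteq> K" for x :: 'a
    using assms by (auto simp: locally_compact_space_def)
  then obtain U K where UK: "\<And>x::'a. open (U x) \<and> compact (K x) \<and> x \<in> U x \<and> U x \<subseteq> K x"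
    by metis
  obtain \<F>' where "\<F>' \<subseteq> range U" "countable \<F>'" "\<Union>\<F>' = \<Union>(range U)"
    using Lindelof[of "range U"] UK by blast
  then obtain T where T: "countable T" "(\<Union>x\<in>T. U x) = UNIV"
    using UK by (metis UNIV_eq_I UnionI countable_subset_image rangeI)
  then have "T \<noteq> {}"
    by auto
  with T obtain t :: "nat \<Rightarrow> 'a" where t: "range t = T"
    by (metis range_from_nat_into)
  define C where "C k = (\<Union>i\<le>k. K (t i))" for k
  have "\<exists>k. L \<subseteq> C k" if "compact L" for L
  proof -
    have "L \<subseteq> (\<Union>i. U (t i))"
      using T(2) unfolding t[symmetric] by auto
    then obtain I where I: "finite I" "L \<subseteq> (\<Union>i\<in>I. U (t i))"
      using compactE_image[OF \<open>compact L\<close>, of UNIV "\<lambda>i. U (t i)"] UK by auto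
    have "L \<subseteq> C (Max I)"
    proof
      fix x assume "x \<in> L"
      then obtain i where "i \<in> I" "x \<in> U (t i)"
        using I by auto
      then show "x \<in> C (Max I)"
        using UK[of "t i"] I Max_ge[of I i] by (auto simp: C_def)
    qed
    then show ?thesis ..
  qed
  moreover have "compact (C k)" for k
    unfolding C_def using UK by (intro compact_UN) auto
  ultimately show ?thesis
    by blast
qed

section \<open>The Borel structure of the hyperspace\<close>

lemma space_hyperspace_borel [simp]: "space hyperspace_borel = nonempty_compacts"
  unfolding hyperspace_borel_def
  by (rule space_measure_of_conv)

text \<open>
  The only way in which smallness of the Hausdorff distance is used: points of one compact set have
  nearby points in the other.
\<close>

lemma hausdorff_distance_lessD:
  assumes "A \<in> nonempty_compacts" "B \<in> nonempty_compacts" "hausdorff_distance A B < e" "x \<in> A"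
  shows "\<exists>y\<in>B. dist x y < e"
proof -
  have "infdist x B < e"
    using hausdorff_distance_le_iff[of A B "hausdorff_distance A B"] assms by fastforce
  moreover have "B \<noteq> {}"
    using assms by (auto simp: nonempty_compacts_def)
  ultimately show ?thesis
    unfolding infdist_def by (auto simp: dest!: cInf_lessD[rotated])
qed

text \<open>
  A set satisfying the ball criterion is open for the Hausdorff metric, hence Borel.  All
  measurability on the hyperspace below comes from here.
\<close>

lemma hyperspace_openI:
  fixes U :: "'a::metric_space set set"
  assumes "U \<subseteq> nonempty_compacts"
    and "\<And>K. K \<in> U \<Longrightarrow> \<exists>r>0. \<forall>L\<in>nonempty_compacts. hausdorff_distance K L < r \<longrightarrow> L \<in> U"
  shows "U \<in> sets hyperspace_borel"
proof -
  interpret H: Metric_space "nonempty_compacts :: 'a set set" hausdorff_distance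
    by (rule Metric_space_hausdorff)
  have "openin H.mtopology U"
    unfolding H.openin_mtopology using assms by (fastforce simp: H.in_mball)
  moreover have "{U. openin H.mtopology U} \<subseteq> Pow nonempty_compacts"
    using openin_subset by fastforce
  ultimately show ?thesis
    unfolding hyperspace_borel_def by (simp add: sets_measure_of sigma_sets.Basic)
qed

lemma hitting_set_measurable:
  assumes "open V"
  shows "{K \<in> nonempty_compacts. K \<inter> V \<noteq> {}} \<in> sets hyperspace_borel"
proof (rule hyperspace_openI)
  fix K assume "K \<in> {K \<in> nonempty_compacts. K \<inter> V \<noteq> {}}"
  then obtain x where x: "K \<in> nonempty_compacts" "x \<in> K" "x \<in> V"
    by auto
  with assms obtain e where e: "e > 0" "ball x e \<subseteq> V"
    by (auto simp: open_contains_ball)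
  have "L \<inter> V \<noteq> {}" if "L \<in> nonempty_compacts" "hausdorff_distance K L < e" for L
    using hausdorff_distance_lessD[OF x(1) that x(2)] e by (auto simp: subset_iff)
  then show "\<exists>r>0. \<forall>L\<in>nonempty_compacts. hausdorff_distance K L < r \<longrightarrow>
      L \<in> {K \<in> nonempty_compacts. K \<inter> V \<noteq> {}}"
    using e by auto
qed auto

lemma image_mem_nonempty_compacts:
  assumes "continuous_on UNIV f" "K \<in> nonempty_compacts"
  shows "f ` K \<in> nonempty_compacts"
  using assms compact_continuous_image[of K f] continuous_on_subset[of UNIV f K]
  by (auto simp: nonempty_compacts_def)

text \<open>
  By compactness \<open>f\<close> is uniformly continuous, so that taking images is continuous for the
  Hausdorff metric.  This makes the induced action on the hyperspace measurable, without which the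
  image measures in \<^const>\<open>invariant_prob\<close> would carry no information.
\<close>

lemma image_measurable_hyperspace:
  fixes f :: "'a::metric_space \<Rightarrow> 'b::metric_space"
  assumes "continuous_on UNIV f" "compact (UNIV :: 'a set)"
  shows "(\<lambda>K. f ` K) \<in> measurable hyperspace_borel hyperspace_borel"
  unfolding hyperspace_borel_def[where 'x = 'b]
proof (rule measurable_measure_of)
  interpret H: Metric_space "nonempty_compacts :: 'b set set" hausdorff_distance
    by (rule Metric_space_hausdorff)
  show "{U. openin H.mtopology U} \<subseteq> Pow nonempty_compacts"
    using openin_subset by fastforce
  show "(\<lambda>K. f ` K) \<in> space hyperspace_borel \<rightarrow> nonempty_compacts"
    using image_mem_nonempty_compacts[OF assms(1)] by simp
  fix U assume "U \<in> {U. openin H.mtopology U}"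
  then have U: "\<And>K. K \<in> U \<Longrightarrow> K \<in> nonempty_compacts \<and> (\<exists>r>0. H.mball K r \<subseteq> U)"
    by (auto simp: H.openin_mtopology)
  show "(\<lambda>K. f ` K) -` U \<inter> space hyperspace_borel \<in> sets hyperspace_borel"
  proof (rule hyperspace_openI)
    fix K assume "K \<in> (\<lambda>K. f ` K) -` U \<inter> space hyperspace_borel"
    then have K: "K \<in> nonempty_compacts" "f ` K \<in> U"
      by auto
    then obtain r where r: "r > 0" "H.mball (f ` K) r \<subseteq> U"
      using U by blast
    have "uniformly_continuous_on UNIV f"
      using assms by (rule compact_uniformly_continuous)
    then obtain e where e: "e > 0" "\<And>x y. dist x y < e \<Longrightarrow> dist (f x) (f y) < r / 2"
      using r(1) by (metis UNIV_I dist_commute half_gt_zero uniformly_continuous_on_def)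
    have near: "infdist y (f ` B) \<le> r / 2"
      if y: "y \<in> f ` A" and near: "A \<in> nonempty_compacts" "B \<in> nonempty_compacts" "hausdorff_distance A B < e"
      for y and A B :: "'a set"
    proof -
      obtain a where a: "a \<in> A" "y = f a"
        using \<open>y \<in> f ` A\<close> by auto
      then obtain b where "b \<in> B" "dist a b < e"
        using hausdorff_distance_lessD[OF near a(1)] by blast
      then show ?thesis
        using e(2)[of a b] a infdist_le[of "f b" "f ` B" "f a"] by auto
    qed
    have "f ` L \<in> U" if L: "L \<in> nonempty_compacts" "hausdorff_distance K L < e" for L
    proof -
      interpret HA: Metric_space "nonempty_compacts :: 'a set set" hausdorff_distance
        by (rule Metric_space_hausdorff)
      have *: "f ` K \<in> nonempty_compacts" "f ` L \<in> nonempty_compacts"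
        using image_mem_nonempty_compacts[OF assms(1)] K L by auto
      have "hausdorff_distance (f ` K) (f ` L) \<le> r / 2"
        unfolding hausdorff_distance_le_iff[OF *]
        using near[of _ K L] near[of _ L K] K L HA.commute[of K L] by auto
      then show ?thesis
        using r * by (auto simp: subset_iff H.in_mball)
    qed
    then show "\<exists>r>0. \<forall>L\<in>nonempty_compacts. hausdorff_distance K L < r \<longrightarrow>
        L \<in> (\<lambda>K. f ` K) -` U \<inter> space hyperspace_borel"
      using e(1) by auto
  qed auto
qed

section \<open>Continuous actions\<close>

lemma continuous_actionD:
  assumes "continuous_action act"
  shows "act 0 x = x" "act (g + h) x = act g (act h x)"
    "act (- g) (act g x) = x" "act g (act (- g) x) = x"
    "continuous_on UNIV (\<lambda>(g, x). act g x)"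
proof -
  have act: "\<And>x. act 0 x = x" "\<And>g h x. act (g + h) x = act g (act h x)"
    using assms by (auto simp: continuous_action_def)
  show "act 0 x = x" "act (g + h) x = act g (act h x)"
    by (fact act)+
  show "act (- g) (act g x) = x" "act g (act (- g) x) = x"
    using act(2)[of "- g" g x] act(2)[of g "- g" x] act(1) by auto
  show "continuous_on UNIV (\<lambda>(g, x). act g x)"
    using assms by (simp add: continuous_action_def)
qed

lemma continuous_on_act:
  assumes "continuous_action act" "continuous_on A f" "continuous_on A h"
  shows "continuous_on A (\<lambda>x. act (f x) (h x))"
proof -
  have "continuous_on A (\<lambda>x. (\<lambda>(g, x). act g x) (f x, h x))"
    by (rule continuous_on_compose2[OF continuous_actionD(5)[OF assms(1)]])
      (auto intro!: continuous_intros assms)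
  then show ?thesis
    by simp
qed

lemma act_center_commute:
  assumes "continuous_action act" "c \<in> group_center"
  shows "act g (act c x) = act c (act g x)"
proof -
  have "g + c = c + g"
    using assms(2) by (simp add: group_center_def)
  then show ?thesis
    using continuous_actionD(2)[OF assms(1)] by metis
qed

section \<open>Separated subsets of a compact set\<close>

text \<open>
  For compact central \<open>C\<close>, separation forbids \<open>y = c x\<close> with \<open>c \<in> C\<close> for distinct points of the set.
  The points may lie in different orbits of the center, or far apart in the same one; the proof of
  the theorem never has to tell these two cases apart.
\<close>

definition separated :: "('g \<Rightarrow> 'x \<Rightarrow> 'x) \<Rightarrow> 'g set \<Rightarrow> 'x set \<Rightarrow> bool" where
  "separated act C A \<longleftrightarrow> (\<forall>x\<in>A. \<forall>y\<in>A. x \<noteq> y \<longrightarrow> (\<forall>c\<in>C. act c x \<noteq> y))"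

definition spread_compacts :: "('g \<Rightarrow> 'x::topological_space \<Rightarrow> 'x) \<Rightarrow> 'g set \<Rightarrow> nat \<Rightarrow> 'x set set" where
  "spread_compacts act C n =
     {K \<in> nonempty_compacts. \<exists>A\<subseteq>K. finite A \<and> card A = n \<and> separated act C A}"

lemma separated_mono: "separated act D A \<Longrightarrow> C \<subseteq> D \<Longrightarrow> separated act C A"
  by (auto simp: separated_def)

text \<open>
  The relation \<open>y \<in> C x\<close> is closed, being the image of the compact set \<open>C \<times> X\<close>, so its negation
  survives small perturbations of both points.
\<close>

lemma not_related_open:
  fixes act :: "'g::{topological_group_add, t2_space} \<Rightarrow> 'x::metric_space \<Rightarrow> 'x"
  assumes "continuous_action act" "compact (UNIV :: 'x set)" "compact C" "x \<noteq> y" "\<forall>c\<in>C. act c x \<noteq> y"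
  shows "eventually (\<lambda>e. \<forall>x' y'. dist x x' < e \<longrightarrow> dist y y' < e \<longrightarrow>
           x' \<noteq> y' \<and> (\<forall>c\<in>C. act c x' \<noteq> y')) (at_right 0)"
proof -
  define R where "R = (\<lambda>(c, x). (x, act c x)) ` (C \<times> (UNIV :: 'x set))"
  have "compact R"
    unfolding R_def
  proof (intro compact_continuous_image compact_Times assms)
    show "continuous_on (C \<times> UNIV) (\<lambda>(c, x). (x, act c x))"
      unfolding split_def
      by (intro continuous_on_Pair continuous_on_act[OF assms(1)] continuous_intros)
  qed
  then have "open (- R)"
    by (simp add: compact_imp_closed open_Compl)
  moreover have "(x, y) \<in> - R"
    using assms by (auto simp: R_def)
  ultimately obtain U V where UV: "open U" "open V" "x \<in> U" "y \<in> V" "U \<times> V \<subseteq> - R"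
    by (metis mem_Sigma_iff open_prod_elim)
  then obtain a b where ab: "a > 0" "ball x a \<subseteq> U" "b > 0" "ball y b \<subseteq> V"
    by (metis open_contains_ball)
  \<comment> \<open>Half of the distance keeps the perturbed points distinct.\<close>
  define e0 where "e0 = min (min a b) (dist x y / 2)"
  have e0: "e0 > 0"
    using ab assms(4) by (simp add: e0_def)
  have *: "x' \<noteq> y' \<and> (\<forall>c\<in>C. act c x' \<noteq> y')" if "e < e0" "dist x x' < e" "dist y y' < e" for e x' y'
  proof -
    have "x' \<in> U" "y' \<in> V"
      using that ab by (auto simp: e0_def)
    then have "(x', y') \<notin> R"
      using UV by auto
    moreover have "x' \<noteq> y'"
    proof
      assume "x' = y'"
      then have "dist x y < e + e"
        using that dist_triangle2[of x y x'] by (simp add: dist_commute)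
      with that show False
        by (simp add: e0_def)
    qed
    ultimately show ?thesis
      by (auto simp: R_def)
  qed
  show ?thesis
    unfolding eventually_at_right_field using e0 * by (intro exI[of _ e0]) blast
qed

lemma eventually_at_right_0_ex:
  fixes P :: "real \<Rightarrow> bool"
  assumes "eventually P (at_right 0)"
  shows "\<exists>e>0. P e"
  using assms unfolding eventually_at_right_field by (meson dense)

text \<open>
  Containing \<open>n\<close> separated points is an open condition: move each of the points to a nearby point of
  the neighbouring compact set.
\<close>

lemma spread_compacts_measurable:
  fixes act :: "'g::{topological_group_add, t2_space} \<Rightarrow> 'x::metric_space \<Rightarrow> 'x"
  assumes "continuous_action act" "compact (UNIV :: 'x set)" "compact C"
  shows "spread_compacts act C n \<in> sets hyperspace_borel"
proof (rule hyperspace_openI)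
  fix K assume "K \<in> spread_compacts act C n"
  then obtain A where K: "K \<in> nonempty_compacts"
    and A: "A \<subseteq> K" "finite A" "card A = n" "separated act C A"
    by (auto simp: spread_compacts_def)
  have "eventually (\<lambda>e. \<forall>p\<in>{p \<in> A \<times> A. fst p \<noteq> snd p}. \<forall>x' y'. dist (fst p) x' < e \<longrightarrow>
      dist (snd p) y' < e \<longrightarrow> x' \<noteq> y' \<and> (\<forall>c\<in>C. act c x' \<noteq> y')) (at_right 0)"
  proof (rule eventually_ball_finite)
    show "finite {p \<in> A \<times> A. fst p \<noteq> snd p}"
      using A(2) by simp
    show "\<forall>p\<in>{p \<in> A \<times> A. fst p \<noteq> snd p}. eventually (\<lambda>e. \<forall>x' y'. dist (fst p) x' < e \<longrightarrow>
      dist (snd p) y' < e \<longrightarrow> x' \<noteq> y' \<and> (\<forall>c\<in>C. act c x' \<noteq> y')) (at_right 0)"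
    proof
      fix p assume "p \<in> {p \<in> A \<times> A. fst p \<noteq> snd p}"
      then show "eventually (\<lambda>e. \<forall>x' y'. dist (fst p) x' < e \<longrightarrow>
        dist (snd p) y' < e \<longrightarrow> x' \<noteq> y' \<and> (\<forall>c\<in>C. act c x' \<noteq> y')) (at_right 0)"
        using A(4) by (intro not_related_open[OF assms]) (auto simp: separated_def)
    qed
  qed
  from this[THEN eventually_at_right_0_ex]
  obtain e where "e > 0" and e_all: "\<forall>p\<in>{p \<in> A \<times> A. fst p \<noteq> snd p}. \<forall>x' y'. dist (fst p) x' < e \<longrightarrow>
      dist (snd p) y' < e \<longrightarrow> x' \<noteq> y' \<and> (\<forall>c\<in>C. act c x' \<noteq> y')"
    by blast
  have e: "x' \<noteq> y' \<and> (\<forall>c\<in>C. act c x' \<noteq> y')"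
    if "x \<in> A" "y \<in> A" "x \<noteq> y" "dist x x' < e" "dist y y' < e" for x y x' y'
    using bspec[OF e_all, of "(x, y)"] that by simp
  have "L \<in> spread_compacts act C n" if L: "L \<in> nonempty_compacts" "hausdorff_distance K L < e" for L
  proof -
    have "\<forall>x\<in>A. \<exists>y\<in>L. dist x y < e"
      using hausdorff_distance_lessD[OF K L] A(1) by auto
    then obtain f where f: "\<And>x. x \<in> A \<Longrightarrow> f x \<in> L \<and> dist x (f x) < e"
      by metis
    have "inj_on f A"
    proof (rule inj_onI, rule ccontr)
      fix x y assume "x \<in> A" "y \<in> A" "f x = f y" "x \<noteq> y"
      then show False
        using e[of x y "f x" "f y"] f[of x] f[of y] by simp
    qed
    moreover have "separated act C (f ` A)"
      unfolding separated_def
    proof (intro ballI impI)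
      fix u v c assume uv: "u \<in> f ` A" "v \<in> f ` A" "u \<noteq> v" "c \<in> C"
      then obtain x y where "x \<in> A" "y \<in> A" "u = f x" "v = f y"
        by auto
      with uv show "act c u \<noteq> v"
        using e[of x y u v] f[of x] f[of y] by auto
    qed
    ultimately show ?thesis
      using L f A unfolding spread_compacts_def by (intro CollectI conjI exI[of _ "f ` A"])
        (auto simp: card_image)
  qed
  then show "\<exists>r>0. \<forall>L\<in>nonempty_compacts. hausdorff_distance K L < r \<longrightarrow> L \<in> spread_compacts act C n"
    using \<open>e > 0\<close> by auto
qed (auto simp: spread_compacts_def)

text \<open>
  Elements of \<open>C\<close> are central, so they commute with the action and separation is invariant.
\<close>

lemma separated_image:
  assumes "continuous_action act" "C \<subseteq> group_center" "separated act C A"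
  shows "separated act C (act g ` A)"
  unfolding separated_def
proof (intro ballI impI)
  fix u v c assume uv: "u \<in> act g ` A" "v \<in> act g ` A" "u \<noteq> v" "c \<in> C"
  then obtain x y where xy: "x \<in> A" "y \<in> A" "u = act g x" "v = act g y" "x \<noteq> y"
    by auto
  then have "act c x \<noteq> y"
    using uv(4) assms(3) by (simp add: separated_def)
  then have "act g (act c x) \<noteq> act g y"
    using continuous_actionD(3)[OF assms(1)] by metis
  then show "act c u \<noteq> v"
    using act_center_commute[OF assms(1), of c g x] uv(4) xy(3,4) assms(2) by auto
qed

lemma spread_compacts_image:
  assumes "continuous_action act" "C \<subseteq> group_center" "K \<in> spread_compacts act C n"
  shows "act g ` K \<in> spread_compacts act C n"
proof -
  obtain A where A: "A \<subseteq> K" "finite A" "card A = n" "separated act C A" "K \<in> nonempty_compacts"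
    using assms(3) by (auto simp: spread_compacts_def)
  have "inj (act g)"
    using continuous_actionD(3)[OF assms(1)] by (metis injI)
  then have "card (act g ` A) = n"
    using A by (metis card_image inj_on_subset subset_UNIV)
  moreover have "act g ` K \<in> nonempty_compacts"
    by (intro image_mem_nonempty_compacts A continuous_on_act[OF assms(1)] continuous_intros)
  ultimately show ?thesis
    using A separated_image[OF assms(1,2) A(4), of g] unfolding spread_compacts_def
    by (intro CollectI conjI exI[of _ "act g ` A"]) auto
qed

text \<open>
  This turns the negative condition of not being a finite union of compact pieces of central orbits
  into the positive one that the proof can use.  If separated subsets of \<open>K\<close> cannot be enlarged beyond
  some finite size, then a maximal one, translated by \<open>C\<close> and \<open>- C\<close>, covers \<open>K\<close>, and \<open>K\<close> is such a
  union.  Conversely, if \<open>K\<close> is covered by \<open>C\<close>-translates of \<open>k\<close> points, then among \<open>k + 1\<close> points of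
  \<open>K\<close> two lie over the same point and differ by an element of \<open>C - C\<close>.
\<close>

lemma not_central_orbit_compacts_iff:
  fixes act :: "'g::{topological_group_add, t2_space} \<Rightarrow> 'x::metric_space \<Rightarrow> 'x"
  assumes act: "continuous_action act" and K: "K \<in> nonempty_compacts"
  shows "K \<notin> central_orbit_compacts act \<longleftrightarrow>
    (\<forall>C n. compact C \<longrightarrow> C \<subseteq> group_center \<longrightarrow> K \<in> spread_compacts act C n)" (is "_ \<longleftrightarrow> ?R")
proof
  assume notK: "K \<notin> central_orbit_compacts act"
  show ?R
  proof (intro allI impI)
    fix C :: "'g set" and n assume C: "compact C" "C \<subseteq> group_center"
    show "K \<in> spread_compacts act C n"
    proof (induction n)
      case 0
      then show ?case
        using K by (simp add: spread_compacts_def separated_def exI[of _ "{}"])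
    next
      case (Suc n)
      then obtain A where A: "A \<subseteq> K" "finite A" "card A = n" "separated act C A"
        by (auto simp: spread_compacts_def)
      \<comment> \<open>Separation is not symmetric, so both signs are needed to cover points in either relation
        to \<open>A\<close>; the element \<open>0\<close> covers \<open>A\<close> itself and makes the index sets nonempty.\<close>
      define E where "E = insert 0 (C \<union> uminus ` C)"
      have E: "compact E" "E \<subseteq> group_center" "0 \<in> E"
        using C minus_mem_group_center unfolding E_def
        by (auto intro!: compact_insert compact_Un compact_continuous_image continuous_intros
            zero_mem_group_center)
      \<comment> \<open>The empty set is separated, but the finite set in the definition of the central orbit
        compacts has to be nonempty.\<close>
      define B where "B = (if A = {} then {SOME x. x \<in> K} else A)"
      have B: "B \<subseteq> K" "finite B" "B \<noteq> {}" "A \<subseteq> B"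
        using A K by (auto simp: B_def nonempty_compacts_def some_in_eq)
      define I where "I x = {g \<in> E. act g x \<in> K}" for x
      have "\<forall>x\<in>B. compact (I x) \<and> I x \<noteq> {} \<and> I x \<subseteq> group_center"
      proof
        fix x assume "x \<in> B"
        have "closed K"
          using K by (simp add: nonempty_compacts_def compact_imp_closed)
        then have "closed ((\<lambda>g. act g x) -` K)"
          by (intro closed_vimage continuous_on_act[OF act] continuous_intros)
        then have "compact (I x)"
          using compact_Int_closed[OF E(1), of "(\<lambda>g. act g x) -` K"]
          unfolding I_def vimage_def Int_def by simp
        moreover have "0 \<in> I x"
          using \<open>x \<in> B\<close> B E continuous_actionD(1)[OF act] by (auto simp: I_def)
        ultimately show "compact (I x) \<and> I x \<noteq> {} \<and> I x \<subseteq> group_center"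
          using E by (auto simp: I_def)
      qed
      then have "(\<Union>x\<in>B. (\<lambda>g. act g x) ` I x) \<in> central_orbit_compacts act"
        using B unfolding central_orbit_compacts_def by blast
      then have "(\<Union>x\<in>B. (\<lambda>g. act g x) ` I x) \<noteq> K"
        using notK by auto
      moreover have "(\<Union>x\<in>B. (\<lambda>g. act g x) ` I x) \<subseteq> K"
        by (auto simp: I_def)
      ultimately obtain y where y: "y \<in> K" "y \<notin> (\<Union>x\<in>B. (\<lambda>g. act g x) ` I x)"
        by blast
      then have yE: "act c x \<noteq> y" if "x \<in> A" "c \<in> E" for x c
        using that B by (auto simp: I_def)
      have "y \<notin> A"
        using yE[of y 0] E continuous_actionD(1)[OF act] by auto
      moreover have "separated act C (insert y A)"
        unfolding separated_def
      proof (intro ballI impI)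
        fix a b c assume ab: "a \<in> insert y A" "b \<in> insert y A" "a \<noteq> b" "c \<in> C"
        then consider "a \<in> A" "b \<in> A" | "a \<in> A" "b = y" | "a = y" "b \<in> A"
          by auto
        then show "act c a \<noteq> b"
        proof cases
          case 1
          then show ?thesis
            using A(4) ab by (auto simp: separated_def)
        next
          case 2
          then show ?thesis
            using yE[of a c] ab by (auto simp: E_def)
        next
          case 3
          then have "act (- c) b \<noteq> y"
            using yE[of b "- c"] ab by (auto simp: E_def)
          then show ?thesis
            using 3 continuous_actionD(3)[OF act] by metis
        qed
      qed
      ultimately show ?case
        using A y K unfolding spread_compacts_def
        by (intro CollectI conjI exI[of _ "insert y A"]) auto
    qed
  qed
next
  assume R: ?R
  show "K \<notin> central_orbit_compacts act"
  proof
    assume "K \<in> central_orbit_compacts act"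
    then obtain B I where KB: "K = (\<Union>x\<in>B. (\<lambda>g. act g x) ` I x)" "finite B"
      and I: "\<And>x. x \<in> B \<Longrightarrow> compact (I x) \<and> I x \<noteq> {} \<and> I x \<subseteq> group_center"
      by (auto simp: central_orbit_compacts_def)
    define C where "C = (\<Union>x\<in>B. I x)"
    have C: "compact C" "C \<subseteq> group_center"
      using KB I by (auto simp: C_def)
    define D where "D = (\<lambda>(c, d). c + - d) ` (C \<times> C)"
    have "compact D"
      unfolding D_def split_def
      by (intro compact_continuous_image compact_Times C continuous_intros)
    moreover have "D \<subseteq> group_center"
    proof
      fix z assume "z \<in> D"
      then obtain c d where "c \<in> C" "d \<in> C" "z = c + - d"
        by (auto simp: D_def)
      then show "z \<in> group_center"
        using C(2) add_mem_group_center[OF _ minus_mem_group_center, of c d] by auto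
    qed
    ultimately have "K \<in> spread_compacts act D (Suc (card B))"
      using R by blast
    then obtain A where A: "A \<subseteq> K" "finite A" "card A = Suc (card B)" "separated act D A"
      by (auto simp: spread_compacts_def)
    have "\<forall>a\<in>A. \<exists>x\<in>B. \<exists>c\<in>C. a = act c x"
      using A(1) KB(1) unfolding C_def by blast
    then obtain r where r: "\<And>a. a \<in> A \<Longrightarrow> r a \<in> B \<and> (\<exists>c\<in>C. a = act c (r a))"
      by metis
    have "\<not> inj_on r A"
      using card_inj_on_le[of r A B] r A KB by auto
    then obtain a b where ab: "a \<in> A" "b \<in> A" "a \<noteq> b" "r a = r b"
      by (auto simp: inj_on_def)
    then obtain c d where cd: "c \<in> C" "d \<in> C" "a = act c (r a)" "b = act d (r a)"
      using r by metis
    then have "act (d + - c) a = b"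
      using continuous_actionD(2)[OF act, of d "- c" a] continuous_actionD(3)[OF act, of c "r a"] by metis
    moreover have "d + - c \<in> D"
      using cd by (auto simp: D_def)
    ultimately show False
      using A(4) ab by (auto simp: separated_def)
  qed
qed

lemma central_orbit_compacts_subset:
  fixes act :: "'g::{topological_group_add, t2_space} \<Rightarrow> 'x::metric_space \<Rightarrow> 'x"
  assumes act: "continuous_action act"
  shows "central_orbit_compacts act \<subseteq> nonempty_compacts"
proof
  fix K assume "K \<in> central_orbit_compacts act"
  then obtain B I where "K = (\<Union>x\<in>B. (\<lambda>g. act g x) ` I x)" "finite B" "B \<noteq> {}"
      "\<And>x. x \<in> B \<Longrightarrow> compact (I x) \<and> I x \<noteq> {}"
    by (auto simp: central_orbit_compacts_def)
  then show "K \<in> nonempty_compacts"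
    unfolding nonempty_compacts_def
    by (auto intro!: compact_UN compact_continuous_image continuous_on_act[OF act] continuous_intros)
qed

text \<open>
  Hence the complement of \<^term>\<open>central_orbit_compacts act\<close> is a countable intersection of open sets.
  As \<^const>\<open>measure\<close> vanishes on nonmeasurable sets, this measurability is part of what
  IC-rigidity asserts.
\<close>

lemma not_central_orbit_compacts_eq:
  fixes act :: "'g::{topological_group_add, t2_space} \<Rightarrow> 'x::metric_space \<Rightarrow> 'x"
  assumes act: "continuous_action act"
    and C: "\<And>k. compact (C k)" "\<And>K. compact K \<Longrightarrow> \<exists>k. K \<subseteq> C k"
  shows "nonempty_compacts - central_orbit_compacts act =
    (\<Inter>k::nat. \<Inter>n. spread_compacts act (C k \<inter> group_center) n)" (is "?L = ?R")
proof (intro equalityI subsetI)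
  fix K assume "K \<in> ?L"
  then show "K \<in> ?R"
    using not_central_orbit_compacts_iff[OF act, of K] C(1) closed_group_center
    by (auto simp: compact_Int_closed)
next
  fix K assume K: "K \<in> ?R"
  then have KN: "K \<in> nonempty_compacts"
    by (auto simp: spread_compacts_def)
  have "K \<in> spread_compacts act D n" if D: "compact D" "D \<subseteq> group_center" for D n
  proof -
    obtain k where "D \<subseteq> C k \<inter> group_center"
      using C(2)[OF D(1)] D(2) by auto
    moreover have "K \<in> spread_compacts act (C k \<inter> group_center) n"
      using K by auto
    then obtain A where "A \<subseteq> K" "finite A" "card A = n" "separated act (C k \<inter> group_center) A"
      by (auto simp: spread_compacts_def)
    ultimately show ?thesis
      using KN separated_mono[of act "C k \<inter> group_center" A D] unfolding spread_compacts_def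
      by (intro CollectI conjI exI[of _ A]) auto
  qed
  then show "K \<in> ?L"
    using not_central_orbit_compacts_iff[OF act KN] KN by auto
qed

section \<open>Orbits that are close in the mean\<close>

lemma haar_finite_compact:
  assumes "left_haar_measure m" "compact K"
  shows "emeasure m K < \<infinity>"
  using assms by (auto simp: left_haar_measure_def)

text \<open>
  If the distance of two orbits tends to \<open>0\<close> in the mean, then for each \<open>k\<close> there are arbitrarily
  late \<open>n\<close> such that the distance is below \<open>1 / (k + 1)\<close> on more than half of \<open>F n\<close>.  The union \<open>D\<close>
  of these parts along a sequence of such \<open>n\<close> has upper density at least \<open>1 / 2\<close>.  The elements of \<open>D\<close>
  with distance not below \<open>\<epsilon>\<close> come from finitely many of the \<open>F n\<close> and so lie in a compact set, which
  is exactly convergence to \<open>0\<close> along \<open>D\<close>.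
\<close>

lemma weakly_asymptotic_pairI:
  fixes act :: "'g::{topological_group_add, t2_space, second_countable_topology} \<Rightarrow> 'x::metric_space \<Rightarrow> 'x"
  assumes act: "continuous_action act" and m: "left_haar_measure m" and F: "folner_sequence m F"
    and lim: "(\<lambda>n. (LINT g:F n|m. dist (act g x) (act g y)) / measure m (F n)) \<longlonglongrightarrow> 0"
    and "x \<noteq> y"
  shows "weakly_asymptotic_pair m F act x y"
proof -
  define h where "h g = dist (act g x) (act g y)" for g
  have h_cont: "continuous_on UNIV h"
    unfolding h_def by (intro continuous_intros continuous_on_act[OF act])
  have sets_m: "sets m = sets borel"
    using m by (simp add: left_haar_measure_def)
  have h_meas: "h \<in> borel_measurable m"
    using borel_measurable_continuous_onI[OF h_cont] by (simp add: measurable_cong_sets[OF sets_m refl])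
  have F_cpt: "compact (F n)" and F_pos: "measure m (F n) > 0" for n
    using F by (auto simp: folner_sequence_def)
  have F_fin: "emeasure m (F n) < \<infinity>" for n
    by (rule haar_finite_compact[OF m F_cpt])
  have F_sets [measurable]: "F n \<in> sets m" for n
    using F_cpt[of n] by (simp add: sets_m borel_compact)
  define G where "G n e = {g \<in> F n. h g < e}" for n e
  have G_borel: "G n e \<in> sets borel" for n e
  proof -
    have "open (h -` {..<e})"
      by (rule open_vimage[OF open_lessThan h_cont])
    then have "F n \<inter> h -` {..<e} \<in> sets borel"
      using F_sets[of n] by (auto simp: sets_m)
    moreover have "G n e = F n \<inter> h -` {..<e}"
      by (auto simp: G_def)
    ultimately show ?thesis
      by simp
  qed
  have large: "\<exists>n\<ge>n0. measure m (G n e) > measure m (F n) / 2" if "e > 0" for e n0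
  proof -
    have "eventually (\<lambda>n. (LINT g:F n|m. h g) / measure m (F n) < e / 2) sequentially"
      using order_tendstoD(2)[OF lim, of "e / 2"] \<open>e > 0\<close> by (simp add: h_def)
    from eventually_happens'[OF sequentially_bot eventually_conj[OF eventually_ge_at_top[of n0] this]]
    obtain n where n: "n \<ge> n0" "(LINT g:F n|m. h g) / measure m (F n) < e / 2"
      by auto
    have fm: "F n - G n e \<in> fmeasurable m"
      by (rule fmeasurableI2[OF fmeasurableI[OF F_sets F_fin]]) (use F_sets G_borel in \<open>auto simp: sets_m\<close>)
    have "bounded (h ` F n)"
      by (intro compact_imp_bounded compact_continuous_image continuous_on_subset[OF h_cont] F_cpt) auto
    then obtain c where c: "\<And>g. g \<in> F n \<Longrightarrow> norm (h g) \<le> c"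
      by (auto simp: bounded_iff)
    have int: "set_integrable m (F n) h"
      unfolding set_integrable_def
    proof (rule integrableI_bounded_set_indicator)
      show "AE g in m. g \<in> F n \<longrightarrow> norm (h g) \<le> c"
        using c by simp
    qed (use F_fin h_meas in auto)
    have "e * measure m (F n - G n e) = (LINT g|m. e * indicator (F n - G n e) g)"
      using fm by simp
    also have "\<dots> \<le> (LINT g:F n|m. h g)"
      unfolding set_lebesgue_integral_def
    proof (rule integral_mono)
      show "integrable m (\<lambda>g. e * indicator (F n - G n e) g)"
        using fm by (intro integrable_mult_right integrable_real_indicator) (auto simp: fmeasurable_def)
      show "integrable m (\<lambda>g. indicat_real (F n) g *\<^sub>R h g)"
        using int by (simp add: set_integrable_def)
      fix g
      show "e * indicator (F n - G n e) g \<le> indicat_real (F n) g *\<^sub>R h g"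
        by (auto simp: G_def indicator_def h_def)
    qed
    also have "\<dots> < e * (measure m (F n) / 2)"
      using n(2) F_pos[of n] by (simp add: field_simps)
    finally have "measure m (F n - G n e) < measure m (F n) / 2"
      using \<open>e > 0\<close> by simp
    moreover have "measure m (F n - G n e) = measure m (F n) - measure m (G n e)"
    proof (rule measure_Diff)
      show "G n e \<subseteq> F n"
        by (auto simp: G_def)
    qed (use F_fin[of n] F_sets[of n] G_borel[of n e] in \<open>auto simp: sets_m\<close>)
    ultimately show ?thesis
      using n(1) by (intro exI[of _ n]) linarith
  qed
  have "\<exists>s. \<forall>k. measure m (G (s k) (1 / Suc k)) > measure m (F (s k)) / 2 \<and> s k < s (Suc k)"
  proof (rule dependent_nat_choice)
    show "\<exists>n. measure m (G n (1 / Suc 0)) > measure m (F n) / 2"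
      using large[of 1 0] by auto
    show "\<exists>n'. measure m (G n' (1 / Suc (Suc k))) > measure m (F n') / 2 \<and> n < n'" for n k
      using large[of "1 / Suc (Suc k)" "Suc n"] by (auto simp: Suc_le_eq)
  qed
  then obtain s where s: "\<And>k. measure m (G (s k) (1 / Suc k)) > measure m (F (s k)) / 2" "strict_mono s"
    by (auto simp: strict_mono_Suc_iff)
  define D where "D = (\<Union>k. G (s k) (1 / Suc k))"
  have D: "D \<in> sets borel"
    using G_borel by (auto simp: D_def)
  have half: "measure m (F (s k) \<inter> D) / measure m (F (s k)) \<ge> 1 / 2" for k
  proof -
    have "F (s k) \<inter> D \<in> fmeasurable m"
      by (rule fmeasurableI2[OF fmeasurableI[OF F_sets F_fin]]) (use F_sets D in \<open>auto simp: sets_m\<close>)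
    then have "measure m (G (s k) (1 / Suc k)) \<le> measure m (F (s k) \<inter> D)"
      using G_borel by (intro measure_mono_fmeasurable) (auto simp: G_def D_def sets_m)
    with s(1)[of k] F_pos[of "s k"] show ?thesis
      by (simp add: field_simps)
  qed
  have "ereal (1 / 2) \<le> limsup ((\<lambda>n. ereal (measure m (F n \<inter> D) / measure m (F n))) \<circ> s)"
    using half by (intro le_Limsup) (auto simp: o_def)
  also have "\<dots> \<le> upper_density m F D"
    unfolding upper_density_def by (rule limsup_subseq_mono[OF s(2)])
  finally have dens: "upper_density m F D > 0"
    by (rule less_le_trans[rotated]) simp
  have "\<exists>K. compact K \<and> (\<forall>g\<in>D - K. dist (act g x) (act g y) < e)" if "e > 0" for e
  proof -
    obtain k0 where k0: "1 / Suc k0 < e"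
      using nat_approx_posE[OF \<open>e > 0\<close>] by blast
    have "compact (\<Union>k\<le>k0. F (s k))"
      using F_cpt by (intro compact_UN) auto
    moreover have "h g < e" if g: "g \<in> D - (\<Union>k\<le>k0. F (s k))" for g
    proof -
      obtain k where k: "g \<in> G (s k) (1 / Suc k)"
        using g by (auto simp: D_def)
      with g have "k > k0"
        by (force simp: G_def not_le[symmetric])
      then have "1 / Suc k \<le> 1 / Suc k0"
        by (simp add: field_simps)
      with k k0 show ?thesis
        by (auto simp: G_def)
    qed
    ultimately show ?thesis
      by (auto simp: h_def)
  qed
  with D dens \<open>x \<noteq> y\<close> show ?thesis
    unfolding weakly_asymptotic_pair_def by auto
qed

section \<open>Products of off-diagonal joinings\<close>

lemma act_measurable:
  assumes "continuous_action act"
  shows "act g \<in> borel_measurable borel"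
  by (intro borel_measurable_continuous_onI continuous_on_act[OF assms] continuous_intros)

lemma translated_diagonal_eq_distr:
  assumes act: "continuous_action act" and sets: "sets \<mu> = sets borel"
  shows "translated_diagonal act \<mu> I \<gamma> = distr \<mu> (power_borel I) (\<lambda>x. \<lambda>i\<in>I. act (\<gamma> i) x)"
proof -
  have 1: "(\<lambda>x. \<lambda>i\<in>I. x) \<in> measurable \<mu> (power_borel I)"
    by (rule measurable_restrict) (simp add: measurable_ident_sets sets)
  have 2: "(\<lambda>p. \<lambda>i\<in>I. act (\<gamma> i) (p i)) \<in> measurable (power_borel I) (power_borel I)"
    by (intro measurable_restrict measurable_compose[OF _ act_measurable[OF act]] measurable_component_singleton)
  show ?thesis
    unfolding translated_diagonal_def diagonal_joining_def distr_distr[OF 2 1]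
    by (rule distr_cong) auto
qed

lemma translated_diagonal_measurable:
  assumes act: "continuous_action act" and sets: "sets \<mu> = sets borel"
  shows "(\<lambda>x. \<lambda>i\<in>I. act (\<gamma> i) x) \<in> measurable \<mu> (power_borel I)"
  using act_measurable[OF act] by (intro measurable_restrict) (simp add: measurable_cong_sets[OF sets refl])

lemma prob_space_translated_diagonal:
  assumes "continuous_action act" "sets \<mu> = sets borel" "prob_space \<mu>"
  shows "prob_space (translated_diagonal act \<mu> I \<gamma>)"
  unfolding translated_diagonal_eq_distr[OF assms(1,2)]
  by (rule prob_space.prob_space_distr[OF assms(3) translated_diagonal_measurable[OF assms(1,2)]])

lemma measure_translated_diagonal:
  assumes act: "continuous_action act" and sets: "sets \<mu> = sets borel"
    and "finite I" "A \<in> sets borel"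
  shows "measure (translated_diagonal act \<mu> I \<gamma>) (I \<rightarrow>\<^sub>E A) = measure \<mu> {x. \<forall>i\<in>I. act (\<gamma> i) x \<in> A}"
proof -
  have "space \<mu> = UNIV"
    using sets_eq_imp_space_eq[OF sets] by simp
  then have "(\<lambda>x. \<lambda>i\<in>I. act (\<gamma> i) x) -` (I \<rightarrow>\<^sub>E A) \<inter> space \<mu> = {x. \<forall>i\<in>I. act (\<gamma> i) x \<in> A}"
    by (auto simp: PiE_iff)
  moreover have "I \<rightarrow>\<^sub>E A \<in> sets (power_borel I)"
    using assms by (intro sets_PiM_I_finite) auto
  ultimately show ?thesis
    unfolding translated_diagonal_eq_distr[OF act sets]
    by (subst measure_distr[OF translated_diagonal_measurable[OF act sets]]) auto
qed

lemma partition_on_THE_block: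
  assumes "partition_on I P" "B \<in> P" "i \<in> B"
  shows "(THE B. B \<in> P \<and> i \<in> B) = B"
proof (rule the_equality)
  fix B' assume "B' \<in> P \<and> i \<in> B'"
  then show "B' = B"
    using partition_onD2[OF assms(1)] assms(2,3) unfolding disjoint_def by blast
qed (use assms in auto)

lemma direct_product_map_measurable:
  assumes part: "partition_on {..<N} P"
    and sets: "\<And>B. B \<in> P \<Longrightarrow> sets (\<rho> B) = sets (power_borel B)"
  shows "(\<lambda>\<omega>. \<lambda>i\<in>{..<N}. \<omega> (THE B. B \<in> P \<and> i \<in> B) i) \<in> measurable (PiM P \<rho>) (power_borel {..<N})"
proof (rule measurable_restrict)
  fix i assume "i \<in> {..<N}"
  then obtain B where B: "B \<in> P" "i \<in> B"
    using partition_onD1[OF part] by auto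
  have "(\<lambda>p. p i) \<in> measurable (\<rho> B) borel"
    using B by (simp add: measurable_cong_sets[OF sets[OF B(1)] refl])
  from measurable_compose[OF measurable_component_singleton[OF B(1), of \<rho>] this]
  show "(\<lambda>\<omega>. \<omega> (THE B. B \<in> P \<and> i \<in> B) i) \<in> measurable (PiM P \<rho>) borel"
    by (simp add: partition_on_THE_block[OF part B])
qed

text \<open>
  The product measure only sees the factors with index in \<open>P\<close>, while the locales for products of
  probability spaces ask for a probability measure at every index; a point mass fills the gap.
\<close>

lemma finite_product_prob_space_extend:
  assumes "finite P" "\<And>B. B \<in> P \<Longrightarrow> prob_space (\<rho> B)"
  obtains \<rho>' where "finite_product_prob_space \<rho>' P" "\<And>B. B \<in> P \<Longrightarrow> \<rho>' B = \<rho> B" "PiM P \<rho>' = PiM P \<rho>"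
proof
  let ?\<rho>' = "\<lambda>B. if B \<in> P then \<rho> B else return (count_space UNIV) undefined"
  interpret product_prob_space ?\<rho>' P
    by (rule product_prob_spaceI) (auto simp: assms prob_space_return)
  show "finite_product_prob_space ?\<rho>' P"
    by standard (rule assms)
  show "PiM P ?\<rho>' = PiM P \<rho>"
    by (rule PiM_cong) auto
qed auto

text \<open>
  The map from the product over the blocks to the power merely regroups coordinates, and the
  preimage of a cube is the product of the cubes over the blocks.
\<close>

lemma measure_direct_product:
  assumes part: "partition_on {..<N} P"
    and prob: "\<And>B. B \<in> P \<Longrightarrow> prob_space (\<rho> B)"
    and sets: "\<And>B. B \<in> P \<Longrightarrow> sets (\<rho> B) = sets (power_borel B)"
    and A: "A \<in> sets borel"
  shows "measure (direct_product N P \<rho>) ({..<N} \<rightarrow>\<^sub>E A) = (\<Prod>B\<in>P. measure (\<rho> B) (B \<rightarrow>\<^sub>E A))"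
proof -
  have "finite P"
    by (rule finite_elements[OF finite_lessThan part])
  then obtain \<rho>' where "finite_product_prob_space \<rho>' P" and \<rho>': "\<And>B. B \<in> P \<Longrightarrow> \<rho>' B = \<rho> B" "PiM P \<rho>' = PiM P \<rho>"
    using finite_product_prob_space_extend[of P \<rho>] prob by auto
  then interpret finite_product_prob_space \<rho>' P
    by simp
  have fin: "finite B" if "B \<in> P" for B
    using partition_onD1[OF part] that by (metis Union_upper finite_lessThan finite_subset)
  let ?T = "\<lambda>\<omega>. \<lambda>i\<in>{..<N}. \<omega> (THE B. B \<in> P \<and> i \<in> B) i"
  have space: "space (\<rho> B) = (B \<rightarrow>\<^sub>E UNIV)" if "B \<in> P" for B
    using sets_eq_imp_space_eq[OF sets[OF that]] by (simp add: space_PiM)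
  have "?T -` ({..<N} \<rightarrow>\<^sub>E A) \<inter> space (PiM P \<rho>) = (\<Pi>\<^sub>E B\<in>P. B \<rightarrow>\<^sub>E A)"
  proof (intro equalityI subsetI)
    fix \<omega> assume \<omega>: "\<omega> \<in> ?T -` ({..<N} \<rightarrow>\<^sub>E A) \<inter> space (PiM P \<rho>)"
    have "\<omega> B \<in> B \<rightarrow>\<^sub>E A" if "B \<in> P" for B
    proof (rule PiE_I)
      fix i assume "i \<in> B"
      then have "i < N"
        using partition_onD1[OF part] that by auto
      then have "?T \<omega> i \<in> A"
        using \<omega> by (auto simp: PiE_iff)
      then show "\<omega> B i \<in> A"
        using \<open>i < N\<close> partition_on_THE_block[OF part that \<open>i \<in> B\<close>] by simp
    next
      fix i assume "i \<notin> B"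
      then show "\<omega> B i = undefined"
        using \<omega> space[OF that] that by (auto simp: space_PiM PiE_iff extensional_def)
    qed
    then show "\<omega> \<in> (\<Pi>\<^sub>E B\<in>P. B \<rightarrow>\<^sub>E A)"
      using \<omega> by (auto simp: space_PiM PiE_iff)
  next
    fix \<omega> assume \<omega>: "\<omega> \<in> (\<Pi>\<^sub>E B\<in>P. B \<rightarrow>\<^sub>E A)"
    have "?T \<omega> i \<in> A" if i: "i < N" for i
    proof -
      have "i \<in> \<Union>P"
        using partition_onD1[OF part] i by auto
      then obtain B where B: "B \<in> P" "i \<in> B"
        by auto
      then show ?thesis
        using \<omega> i by (auto simp: partition_on_THE_block[OF part B] PiE_iff)
    qed
    moreover have "\<omega> \<in> space (PiM P \<rho>)"
      using \<omega> space by (auto simp: space_PiM PiE_iff)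
    ultimately show "\<omega> \<in> ?T -` ({..<N} \<rightarrow>\<^sub>E A) \<inter> space (PiM P \<rho>)"
      by auto
  qed
  moreover have "{..<N} \<rightarrow>\<^sub>E A \<in> sets (power_borel {..<N})"
    using A by (intro sets_PiM_I_finite) auto
  ultimately have "measure (direct_product N P \<rho>) ({..<N} \<rightarrow>\<^sub>E A) = measure (PiM P \<rho>) (\<Pi>\<^sub>E B\<in>P. B \<rightarrow>\<^sub>E A)"
    unfolding direct_product_def
    by (subst measure_distr[OF direct_product_map_measurable[OF part sets]]) auto
  also have "\<dots> = (\<Prod>B\<in>P. measure (\<rho>' B) (B \<rightarrow>\<^sub>E A))"
    unfolding \<rho>'(2)[symmetric]
    using A fin by (intro finite_measure_PiM_emb) (auto simp: \<rho>' sets intro!: sets_PiM_I_finite)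
  finally show ?thesis
    by (simp add: \<rho>')
qed

text \<open>
  Restricting to the coordinates of a block undoes the regrouping, leaving the projection to one
  factor of the product over the blocks.
\<close>

lemma direct_product_block_marginal:
  assumes part: "partition_on {..<N} P"
    and prob: "\<And>B. B \<in> P \<Longrightarrow> prob_space (\<rho> B)"
    and sets: "\<And>B. B \<in> P \<Longrightarrow> sets (\<rho> B) = sets (power_borel B)"
    and B: "B \<in> P"
  shows "distr (direct_product N P \<rho>) (power_borel B) (\<lambda>p. restrict p B) = \<rho> B"
proof -
  have "finite P"
    by (rule finite_elements[OF finite_lessThan part])
  then obtain \<rho>' where "finite_product_prob_space \<rho>' P" and \<rho>': "\<And>B. B \<in> P \<Longrightarrow> \<rho>' B = \<rho> B" "PiM P \<rho>' = PiM P \<rho>"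
    using finite_product_prob_space_extend[of P \<rho>] prob by auto
  then interpret finite_product_prob_space \<rho>' P
    by simp
  have sub: "B \<subseteq> {..<N}"
    using partition_onD1[OF part] B by auto
  have restr: "(\<lambda>p. restrict p B) \<in> measurable (power_borel {..<N}) (power_borel B)"
    by (rule measurable_restrict_subset[OF sub])
  have map: "(\<lambda>\<omega>. \<lambda>i\<in>{..<N}. \<omega> (THE B. B \<in> P \<and> i \<in> B) i) \<in> measurable (PiM P \<rho>) (power_borel {..<N})"
    by (rule direct_product_map_measurable[OF part]) (rule sets)
  have "distr (direct_product N P \<rho>) (power_borel B) (\<lambda>p. restrict p B) = distr (PiM P \<rho>) (\<rho> B) (\<lambda>\<omega>. \<omega> B)"
    unfolding direct_product_def
    unfolding distr_distr[OF restr map]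
  proof (rule distr_cong)
    fix \<omega> assume "\<omega> \<in> space (PiM P \<rho>)"
    then have "\<omega> B \<in> B \<rightarrow>\<^sub>E UNIV"
      using B sets_eq_imp_space_eq[OF sets[OF B]] by (auto simp: space_PiM PiE_iff)
    then show "((\<lambda>p. restrict p B) \<circ> (\<lambda>\<omega>. \<lambda>i\<in>{..<N}. \<omega> (THE B. B \<in> P \<and> i \<in> B) i)) \<omega> = \<omega> B"
      using sub partition_on_THE_block[OF part B]
      by (auto simp: fun_eq_iff restrict_def PiE_iff extensional_def)
  qed (auto simp: sets B)
  also have "\<dots> = \<rho> B"
    using PiM_component[OF B] by (simp add: \<rho>' B)
  finally show ?thesis .
qed

text \<open>
  On a block the joining is carried by the points \<open>(\<gamma>\<^sub>i x)\<^sub>i\<close>, hence by the graph of \<open>z\<close> in the two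
  coordinates \<open>i\<close> and \<open>j\<close>.  With generic points this will identify \<open>z\<close> as an element that relates two
  coordinates of the point.
\<close>

lemma LINT_direct_product_same_block:
  fixes act :: "'g::{topological_group_add, t2_space} \<Rightarrow> 'x::polish_space \<Rightarrow> 'x"
  assumes act: "continuous_action act" and sets: "sets \<mu> = sets borel" and prob: "prob_space \<mu>"
    and part: "partition_on {..<N} P"
    and \<rho>: "\<And>B. B \<in> P \<Longrightarrow> \<rho> B = translated_diagonal act \<mu> B (\<gamma> B)"
    and B: "B \<in> P" "i \<in> B" "j \<in> B"
    and z: "z + \<gamma> B i = \<gamma> B j"
  shows "(LINT p|direct_product N P \<rho>. dist (p j) (act z (p i))) = 0"
proof -
  have \<rho>_sets: "Sigma_Algebra.sets (\<rho> B) = Sigma_Algebra.sets (power_borel B)" if "B \<in> P" for B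
    by (simp add: \<rho>[OF that] translated_diagonal_def)
  have \<rho>_prob: "prob_space (\<rho> B)" if "B \<in> P" for B
    using prob_space_translated_diagonal[OF act sets prob] \<rho>[OF that] by simp
  have sub: "B \<subseteq> {..<N}"
    using partition_onD1[OF part] B by auto
  have restr: "(\<lambda>p. restrict p B) \<in> measurable (direct_product N P \<rho>) (power_borel B)"
    using measurable_restrict_subset[OF sub, of "\<lambda>_. borel"]
    by (simp add: direct_product_def)
  have act_z [measurable]: "act z \<in> borel_measurable borel"
    by (rule act_measurable[OF act])
  have f_meas: "(\<lambda>p. dist (p j) (act z (p i))) \<in> borel_measurable (power_borel B)"
    by (intro borel_measurable_dist measurable_compose[OF _ act_z] measurable_component_singleton B)
  have marginal: "distr (direct_product N P \<rho>) (power_borel B) (\<lambda>p. restrict p B) = \<rho> B"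
    by (rule direct_product_block_marginal[OF part]) (use \<rho>_prob \<rho>_sets B in auto)
  have "(LINT p|direct_product N P \<rho>. dist (p j) (act z (p i)))
      = (LINT p|distr (direct_product N P \<rho>) (power_borel B) (\<lambda>p. restrict p B). dist (p j) (act z (p i)))"
    by (subst integral_distr[OF restr f_meas]) (simp add: B)
  also have "\<dots> = (LINT x|\<mu>. dist (act (\<gamma> B j) x) (act z (act (\<gamma> B i) x)))"
    unfolding marginal \<rho>[OF B(1)]
      translated_diagonal_eq_distr[OF act sets]
    by (subst integral_distr[OF translated_diagonal_measurable[OF act sets] f_meas]) (simp add: B)
  also have "\<dots> = 0"
    by (simp add: z flip: continuous_actionD(2)[OF act])
  finally show ?thesis .
qed

text \<open>
  A product of factors \<open>q\<^bsup>card B\<^esup>\<close> over the blocks is \<open>q\<^bsup>N\<^esup>\<close> whatever the partition is, and there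
  are at most \<open>N\<close> blocks to contribute an error.
\<close>

lemma measure_direct_product_le:
  fixes q \<delta> :: real
  assumes act: "continuous_action act" and sets: "sets \<mu> = sets borel" and prob: "prob_space \<mu>"
    and part: "partition_on {..<N} P" and A: "A \<in> sets borel"
    and \<rho>: "\<And>B. B \<in> P \<Longrightarrow> \<rho> B = translated_diagonal act \<mu> B (\<gamma> B)"
    and q: "0 \<le> q" "q \<le> 1"
    and est: "\<And>B. B \<in> P \<Longrightarrow> \<bar>measure \<mu> {x. \<forall>i\<in>B. act (\<gamma> B i) x \<in> A} - q ^ card B\<bar> \<le> \<delta>"
  shows "measure (direct_product N P \<rho>) ({..<N} \<rightarrow>\<^sub>E A) \<le> q ^ N + real N * \<delta>"
proof -
  have \<rho>_sets: "Sigma_Algebra.sets (\<rho> B) = Sigma_Algebra.sets (power_borel B)" if "B \<in> P" for B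
    by (simp add: \<rho>[OF that] translated_diagonal_def)
  have \<rho>_prob: "prob_space (\<rho> B)" if "B \<in> P" for B
    using prob_space_translated_diagonal[OF act sets prob] \<rho>[OF that] by simp
  have finP: "finite P"
    by (rule finite_elements[OF finite_lessThan part])
  have U: "\<Union>P = {..<N}"
    using partition_onD1[OF part] by simp
  have fin: "finite B" if "B \<in> P" for B
    using U that by (metis Union_upper finite_lessThan finite_subset)
  have cards: "(\<Sum>B\<in>P. card B) = N"
    using card_Union_disjoint[of P] partition_onD2[OF part] fin U by (simp add: disjoint_def pairwise_def disjnt_def)
  have "card P = (\<Sum>B\<in>P. 1)"
    by simp
  also have "\<dots> \<le> (\<Sum>B\<in>P. card B)"
  proof (rule sum_mono)
    fix B assume "B \<in> P"
    then show "1 \<le> card B"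
      using fin partition_onD3[OF part] by (metis One_nat_def Suc_leI card_gt_0_iff)
  qed
  finally have cardP: "card P \<le> N"
    using cards by simp
  let ?c = "\<lambda>B. measure \<mu> {x. \<forall>i\<in>B. act (\<gamma> B i) x \<in> A}"
  have c: "measure (\<rho> B) (B \<rightarrow>\<^sub>E A) = ?c B" if "B \<in> P" for B
    using measure_translated_diagonal[OF act sets fin[OF that] A] by (simp add: \<rho>[OF that])
  have "\<bar>(\<Prod>B\<in>P. ?c B) - (\<Prod>B\<in>P. q ^ card B)\<bar> \<le> (\<Sum>B\<in>P. \<bar>?c B - q ^ card B\<bar>)"
    using norm_prod_diff[of P ?c "\<lambda>B. q ^ card B"] q
    by (simp add: power_le_one prob_space.prob_le_1[OF prob])
  also have "\<dots> \<le> (\<Sum>B\<in>P. \<delta>)"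
    by (intro sum_mono est)
  also have "\<dots> \<le> real N * \<delta>"
  proof (cases "P = {}")
    case False
    then have "\<delta> \<ge> 0"
      using est by fastforce
    then show ?thesis
      using cardP by (simp add: mult_right_mono)
  next
    case True
    then have "0 \<notin> {..<N}"
      using U by blast
    then show ?thesis
      using True by simp
  qed
  finally have "(\<Prod>B\<in>P. ?c B) \<le> (\<Prod>B\<in>P. q ^ card B) + real N * \<delta>"
    by simp
  also have "(\<Prod>B\<in>P. q ^ card B) = q ^ N"
    by (simp add: power_sum cards[symmetric])
  finally show ?thesis
    using measure_direct_product[OF part \<rho>_prob \<rho>_sets A] c by simp
qed

section \<open>Consequences of mixing and minimality\<close>

text \<open>
  Mixing is needed for all block sizes up to \<open>N\<close> with one common compact set.  Blocks of one element
  are handled by invariance; a block of \<open>k + 1\<close> elements is enumerated by \<open>{..k}\<close>, and mixing of order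
  \<open>k\<close> is applied to the inverses of the \<open>\<gamma>\<^sub>i\<close>.
\<close>

lemma mixing_block:
  fixes act :: "'g::{topological_group_add, t2_space} \<Rightarrow> 'x::polish_space \<Rightarrow> 'x"
  assumes act: "continuous_action act" and inv: "invariant_prob borel act \<mu>"
    and mix: "mixing_of_all_orders act \<mu>" and A: "A \<in> sets borel" and "\<delta> > 0"
  shows "\<exists>L. compact L \<and> (\<forall>B \<gamma>. finite B \<longrightarrow> B \<noteq> {} \<longrightarrow> card B \<le> N \<longrightarrow>
      (\<forall>i\<in>B. \<forall>j\<in>B. i \<noteq> j \<longrightarrow> \<gamma> i - \<gamma> j \<notin> L) \<longrightarrow>
      \<bar>measure \<mu> {x. \<forall>i\<in>B. act (\<gamma> i) x \<in> A} - measure \<mu> A ^ card B\<bar> < \<delta>)"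
proof -
  have sets: "sets \<mu> = sets borel"
    using inv by (simp add: invariant_prob_def)
  define good where "good k L \<longleftrightarrow> compact L \<and> (\<forall>g. (\<forall>i\<le>k. \<forall>j\<le>k. i \<noteq> j \<longrightarrow> - g i + g j \<notin> L) \<longrightarrow>
      \<bar>measure \<mu> (\<Inter>i\<le>k. act (g i) ` A) - (\<Prod>i\<le>k. measure \<mu> A)\<bar> < \<delta>)" for k :: nat and L
  have "\<forall>k\<in>{1..}. \<exists>L. good k L"
  proof
    fix k :: nat assume "k \<in> {1..}"
    then show "\<exists>L. good k L"
      using mix[unfolded mixing_of_all_orders_def, rule_format, of k "\<lambda>_. A" \<delta>] A \<open>\<delta> > 0\<close>
      unfolding good_def by simp
  qed
  from bchoice[OF this] obtain L where good: "\<And>k. k \<ge> 1 \<Longrightarrow> good k (L k)"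
    by auto
  then have L: "compact (L k)"
    "(\<And>i j. i \<le> k \<Longrightarrow> j \<le> k \<Longrightarrow> i \<noteq> j \<Longrightarrow> - g i + g j \<notin> L k) \<Longrightarrow>
      \<bar>measure \<mu> (\<Inter>i\<le>k. act (g i) ` A) - (\<Prod>i\<le>k. measure \<mu> A)\<bar> < \<delta>" if "k \<ge> 1" for k g
    using that unfolding good_def by blast+
  have "\<bar>measure \<mu> {x. \<forall>i\<in>B. act (\<gamma> i) x \<in> A} - measure \<mu> A ^ card B\<bar> < \<delta>"
    if B: "finite B" "B \<noteq> {}" "card B \<le> N"
      and far: "\<forall>i\<in>B. \<forall>j\<in>B. i \<noteq> j \<longrightarrow> \<gamma> i - \<gamma> j \<notin> (\<Union>k\<in>{1..N}. L k)" for B and \<gamma> :: "_ \<Rightarrow> 'g"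
  proof (cases "card B = 1")
    case True
    then obtain i where i: "B = {i}"
      by (auto simp: card_1_singleton_iff)
    have "measure \<mu> (act (\<gamma> i) -` A \<inter> space \<mu>) = measure (distr \<mu> borel (act (\<gamma> i))) A"
      using act_measurable[OF act, of "\<gamma> i"] A by (subst measure_distr) (simp_all add: measurable_cong_sets[OF sets refl])
    also have "\<dots> = measure \<mu> A"
      using inv by (simp add: invariant_prob_def)
    finally have "measure \<mu> {x. act (\<gamma> i) x \<in> A} = measure \<mu> A"
      using sets_eq_imp_space_eq[OF sets] by (simp add: vimage_def)
    then show ?thesis
      using i \<open>\<delta> > 0\<close> by simp
  next
    case False
    define k where "k = card B - 1"
    have "card B \<noteq> 0"
      using B by simp
    then have k: "k \<ge> 1" "k \<le> N" "card B = Suc k"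
      using False B unfolding k_def by linarith+
    obtain h where h: "bij_betw h {0..<card B} B"
      using ex_bij_betw_nat_finite[OF B(1)] by blast
    moreover have "{0..<card B} = {..k}"
      using k(3) by auto
    ultimately have h: "bij_betw h {..k} B"
      by simp
    have img: "act (- g) ` A = {x. act g x \<in> A}" for g
    proof (intro equalityI subsetI)
      fix x assume "x \<in> {x. act g x \<in> A}"
      then show "x \<in> act (- g) ` A"
        using continuous_actionD(3)[OF act, of g x] by (intro image_eqI[of _ _ "act g x"]) auto
    qed (auto simp: continuous_actionD(4)[OF act])
    have "(\<Inter>i\<le>k. act (- \<gamma> (h i)) ` A) = {x. \<forall>i\<in>B. act (\<gamma> i) x \<in> A}"
      unfolding img using h by (auto simp: bij_betw_def)
    moreover have "- (- \<gamma> (h i)) + - \<gamma> (h j) \<notin> L k" if "i \<le> k" "j \<le> k" "i \<noteq> j" for i j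
    proof -
      have "h i \<in> B" "h j \<in> B" "h i \<noteq> h j"
        using h that by (auto simp: bij_betw_def inj_on_def)
      then show ?thesis
        using far k by auto
    qed
    ultimately show ?thesis
      using L(2)[OF k(1), of "\<lambda>i. - \<gamma> (h i)"] k(3) by simp
  qed
  moreover have "compact (\<Union>k\<in>{1..N}. L k)"
    using L by (intro compact_UN) auto
  ultimately show ?thesis
    by blast
qed

text \<open>
  By minimality the translates of \<open>U\<close> cover the space, and finitely many of them suffice; if \<open>U\<close> were
  null, then so would be the whole space.
\<close>

lemma open_measure_pos:
  fixes act :: "'g::{topological_group_add, t2_space} \<Rightarrow> 'x::polish_space \<Rightarrow> 'x"
  assumes act: "continuous_action act" and inv: "invariant_prob borel act \<mu>"
    and min: "minimal_action act" and cpt: "compact (UNIV :: 'x set)" and U: "open U" "U \<noteq> {}"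
  shows "measure \<mu> U > 0"
proof (rule ccontr)
  assume "\<not> measure \<mu> U > 0"
  interpret prob_space \<mu>
    using inv by (simp add: invariant_prob_def)
  have sets: "sets \<mu> = sets borel"
    using inv by (simp add: invariant_prob_def)
  have space: "space \<mu> = UNIV"
    using sets_eq_imp_space_eq[OF sets] by simp
  have meas: "act g \<in> measurable \<mu> borel" for g
    using act_measurable[OF act, of g] by (simp add: measurable_cong_sets[OF sets refl])
  have "measure \<mu> (act g -` U) = 0" for g
  proof -
    have "measure \<mu> (act g -` U \<inter> space \<mu>) = measure (distr \<mu> borel (act g)) U"
      using meas[of g] U by (subst measure_distr) auto
    also have "\<dots> = measure \<mu> U"
      using inv by (simp add: invariant_prob_def)
    also have "\<dots> = 0"
      using \<open>\<not> measure \<mu> U > 0\<close> by (simp add: order.antisym not_less)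
    finally show ?thesis
      by (simp add: space)
  qed
  moreover have op: "open (act g -` U)" for g
    by (intro open_vimage U continuous_on_act[OF act] continuous_intros)
  ultimately have null: "act g -` U \<in> null_sets \<mu>" for g
    by (simp add: null_sets_def emeasure_eq_measure sets)
  have "\<exists>g. act g x \<in> U" for x
  proof -
    have "closure (range (\<lambda>g. act g x)) = UNIV"
      using min by (simp add: minimal_action_def)
    then have "U \<inter> range (\<lambda>g. act g x) \<noteq> {}"
      using U open_Int_closure_eq_empty[of U "range (\<lambda>g. act g x)"] by auto
    then show ?thesis
      by auto
  qed
  then have "UNIV \<subseteq> (\<Union>g. act g -` U)"
    by auto
  then obtain D where D: "finite D" "UNIV \<subseteq> (\<Union>g\<in>D. act g -` U)"
    using compactE_image[OF cpt, of UNIV "\<lambda>g. act g -` U"] op by auto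
  have "(\<Union>g\<in>D. act g -` U) \<in> null_sets \<mu>"
    using D null by (intro null_sets_UN') (auto simp: countable_finite)
  then have "measure \<mu> UNIV = 0"
    using D(2) by (simp add: null_sets_def measure_def top.extremum_unique)
  then show False
    using prob_space space by simp
qed

section \<open>Translates of a compact set that miss a ball\<close>

text \<open>
  Unique ergodicity makes every invariant measure on a power a self-joining.
\<close>

lemma coordinate_marginal_eq:
  fixes act :: "'g::{topological_group_add, t2_space} \<Rightarrow> 'x::polish_space \<Rightarrow> 'x"
  assumes act: "continuous_action act" and \<mu>: "invariant_prob borel act \<mu>" and ue: "uniquely_ergodic act"
    and \<nu>: "invariant_prob (power_borel I) (power_act I act) \<nu>" and "i \<in> I"
  shows "distr \<nu> borel (\<lambda>p. p i) = \<mu>"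
proof -
  interpret prob_space \<nu>
    using \<nu> by (simp add: invariant_prob_def)
  have sets: "sets \<nu> = sets (power_borel I)"
    using \<nu> by (simp add: invariant_prob_def)
  have proj: "(\<lambda>p. p i) \<in> borel_measurable (power_borel I)"
    using \<open>i \<in> I\<close> by (rule measurable_component_singleton)
  then have proj\<nu>: "(\<lambda>p. p i) \<in> borel_measurable \<nu>"
    by (simp add: measurable_cong_sets[OF sets refl])
  have power: "power_act I act g \<in> measurable (power_borel I) (power_borel I)" for g
    unfolding power_act_def
    by (intro measurable_restrict measurable_compose[OF _ act_measurable[OF act]] measurable_component_singleton)
  then have power\<nu>: "power_act I act g \<in> measurable \<nu> (power_borel I)" for g
    by (simp add: measurable_cong_sets[OF sets refl])
  have "distr (distr \<nu> borel (\<lambda>p. p i)) borel (act g) = distr \<nu> borel (\<lambda>p. p i)" for g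
  proof -
    have "distr (distr \<nu> borel (\<lambda>p. p i)) borel (act g) = distr \<nu> borel (act g \<circ> (\<lambda>p. p i))"
      by (rule distr_distr[OF act_measurable[OF act] proj\<nu>])
    also have "\<dots> = distr \<nu> borel ((\<lambda>p. p i) \<circ> power_act I act g)"
      using \<open>i \<in> I\<close> by (intro distr_cong) (auto simp: power_act_def)
    also have "\<dots> = distr (distr \<nu> (power_borel I) (power_act I act g)) borel (\<lambda>p. p i)"
      by (rule distr_distr[OF proj power\<nu>, symmetric])
    finally show ?thesis
      using \<nu> by (simp add: invariant_prob_def)
  qed
  then have "invariant_prob borel act (distr \<nu> borel (\<lambda>p. p i))"
    using prob_space_distr[OF proj\<nu>] by (simp add: invariant_prob_def)
  then show ?thesis
    using ue \<mu> unfolding uniquely_ergodic_def by blast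
qed

lemma continuous_map_coordinate:
  fixes h :: "'x::topological_space \<Rightarrow> 'y::topological_space"
  assumes "i \<in> I" "continuous_on UNIV h"
  shows "continuous_map (product_topology (\<lambda>_. euclidean) I) euclidean (\<lambda>p. h (p i))"
proof -
  have "continuous_map (product_topology (\<lambda>_. euclidean) I) euclidean (h \<circ> (\<lambda>p. p i))"
    using assms by (intro continuous_map_compose[OF continuous_map_product_projection]) auto
  then show ?thesis
    by (simp add: o_def)
qed

lemma continuous_map_dist_coordinates:
  fixes h :: "'x::metric_space \<Rightarrow> 'x"
  assumes "i \<in> I" "j \<in> I" "continuous_on UNIV h"
  shows "continuous_map (product_topology (\<lambda>_. euclidean) I) euclideanreal (\<lambda>p. dist (p j) (h (p i)))"
proof -
  have "continuous_map (product_topology (\<lambda>_. euclidean) I) (prod_topology euclidean euclidean) (\<lambda>p. (p j, h (p i)))"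
    using assms by (intro continuous_map_pairedI continuous_map_coordinate continuous_map_product_projection)
  moreover have "continuous_map (prod_topology euclidean euclidean) euclideanreal (\<lambda>(x, y). dist (x :: 'x) y)"
    by (simp add: split_def euclidean_product_topology continuous_on_dist continuous_on_fst continuous_on_snd)
  ultimately have "continuous_map (product_topology (\<lambda>_. euclidean) I) euclideanreal
      ((\<lambda>(x, y). dist x y) \<circ> (\<lambda>p. (p j, h (p i))))"
    by (rule continuous_map_compose)
  then show ?thesis
    by (simp add: o_def)
qed

text \<open>
  The measure \<open>\<nu>\<close> is a self-joining, hence a product of off-diagonal joinings.  If \<open>i\<close> and \<open>j\<close> are in
  one block, then \<open>\<gamma>\<^sub>j = z + \<gamma>\<^sub>i\<close> with \<open>z\<close> central, and \<open>\<nu>\<close> is carried by the set where \<open>p\<^sub>j = z p\<^sub>i\<close>.  As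
  \<open>p\<close> is generic, the orbits of \<open>p\<^sub>j\<close> and \<open>z p\<^sub>i\<close> are close in the mean, so in the absence of weakly
  asymptotic pairs \<open>p\<^sub>j = z p\<^sub>i\<close> holds for the point itself.  Separation of the coordinates therefore
  keeps \<open>- z = \<gamma>\<^sub>i - \<gamma>\<^sub>j\<close> out of \<open>L\<close>, and on every block \<open>\<nu>\<close> behaves on cubes like a power of \<open>\<mu>\<close>.
\<close>

lemma generic_measure_PiE_le:
  fixes act :: "'g::{topological_group_add, t2_space, second_countable_topology} \<Rightarrow> 'x::polish_space \<Rightarrow> 'x"
  assumes act: "continuous_action act" and m: "left_haar_measure m" and F: "folner_sequence m F"
    and \<mu>: "invariant_prob borel act \<mu>" and ue: "uniquely_ergodic act"
    and msj: "minimal_self_joinings_of_all_orders act \<mu>"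
    and no_pair: "\<not> (\<exists>x y. weakly_asymptotic_pair m F act x y)"
    and erg: "ergodic_prob (power_borel {..<N}) (power_act {..<N} act) \<nu>"
    and gen: "generic_point m F act N \<nu> p"
    and "N \<ge> 2" and A: "A \<in> sets borel"
    and sep: "\<And>i j z. i < N \<Longrightarrow> j < N \<Longrightarrow> i \<noteq> j \<Longrightarrow> z \<in> group_center \<Longrightarrow> - z \<in> L \<Longrightarrow> act z (p i) \<noteq> p j"
    and L: "\<And>B :: nat set. \<And>\<gamma>. finite B \<Longrightarrow> B \<noteq> {} \<Longrightarrow> card B \<le> N \<Longrightarrow>
      (\<forall>i\<in>B. \<forall>j\<in>B. i \<noteq> j \<longrightarrow> \<gamma> i - \<gamma> j \<notin> L) \<Longrightarrow>
      \<bar>measure \<mu> {x. \<forall>i\<in>B. act (\<gamma> i) x \<in> A} - measure \<mu> A ^ card B\<bar> < \<delta>"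
  shows "measure \<nu> ({..<N} \<rightarrow>\<^sub>E A) \<le> measure \<mu> A ^ N + real N * \<delta>"
proof -
  have prob: "prob_space \<mu>" and sets: "sets \<mu> = sets borel"
    using \<mu> by (auto simp: invariant_prob_def)
  have inv: "invariant_prob (power_borel {..<N}) (power_act {..<N} act) \<nu>"
    using erg by (simp add: ergodic_prob_def)
  then have "self_joining act \<mu> N \<nu>"
    using coordinate_marginal_eq[OF act \<mu> ue inv] by (simp add: self_joining_def)
  then have "trivial_joining act \<mu> N \<nu>"
    using msj erg \<open>N \<ge> 2\<close> by (auto simp: minimal_self_joinings_of_all_orders_def)
  then obtain P \<rho> where part: "partition_on {..<N} P"
    and off: "\<forall>B\<in>P. off_diagonal_joining act \<mu> B (\<rho> B)" and \<nu>: "\<nu> = direct_product N P \<rho>"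
    by (auto simp: trivial_joining_def)
  from bchoice[OF off[unfolded off_diagonal_joining_def]]
  obtain \<gamma> where central: "\<And>B i j. B \<in> P \<Longrightarrow> i \<in> B \<Longrightarrow> j \<in> B \<Longrightarrow> - \<gamma> B i + \<gamma> B j \<in> group_center"
    and \<rho>: "\<And>B. B \<in> P \<Longrightarrow> \<rho> B = translated_diagonal act \<mu> B (\<gamma> B)"
    by auto
  have sub: "B \<subseteq> {..<N}" if "B \<in> P" for B
    using partition_onD1[OF part] that by auto
  have far: "\<gamma> B i - \<gamma> B j \<notin> L" if B: "B \<in> P" "i \<in> B" "j \<in> B" and "i \<noteq> j" for B i j
  proof -
    define z where "z = - \<gamma> B i + \<gamma> B j"
    have z: "z \<in> group_center"
      unfolding z_def by (rule central[OF B])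
    have ij: "i < N" "j < N"
      using sub[OF B(1)] B by auto
    have "\<gamma> B i + z = \<gamma> B j"
      by (simp add: z_def add.assoc[symmetric])
    then have z\<gamma>: "z + \<gamma> B i = \<gamma> B j"
      using z by (simp add: group_center_def)
    have "continuous_on UNIV (act z)"
      by (intro continuous_on_act[OF act] continuous_intros)
    then have "continuous_map (product_topology (\<lambda>_. euclidean) {..<N}) euclideanreal (\<lambda>p. dist (p j) (act z (p i)))"
      using ij by (intro continuous_map_dist_coordinates) auto
    moreover have "(LINT p|\<nu>. dist (p j) (act z (p i))) = 0"
      unfolding \<nu> by (rule LINT_direct_product_same_block[OF act sets prob part \<rho> B z\<gamma>])
    ultimately have "(\<lambda>n. (LINT g:F n|m. dist (power_act {..<N} act g p j) (act z (power_act {..<N} act g p i)))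
        / measure m (F n)) \<longlonglongrightarrow> 0"
      using gen by (auto simp: generic_point_def)
    then have "(\<lambda>n. (LINT g:F n|m. dist (act g (p j)) (act g (act z (p i)))) / measure m (F n)) \<longlonglongrightarrow> 0"
      using ij by (simp add: power_act_def act_center_commute[OF act z])
    then have "p j = act z (p i)"
      using weakly_asymptotic_pairI[OF act m F] no_pair by blast
    then have "- z \<notin> L"
      using sep[OF ij \<open>i \<noteq> j\<close> z] by auto
    moreover have "\<gamma> B i - \<gamma> B j = - z"
      unfolding z\<gamma>[symmetric] by (simp add: diff_conv_add_uminus minus_add add.assoc[symmetric] del: add_uminus_conv_diff)
    ultimately show ?thesis
      by simp
  qed
  show ?thesis
    unfolding \<nu>
  proof (rule measure_direct_product_le[OF act sets prob part A \<rho>])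
    fix B assume "B \<in> P"
    then have "finite B" "B \<noteq> {}" "card B \<le> N"
      using sub[of B] partition_onD3[OF part] card_mono[of "{..<N}" B] finite_subset[of B "{..<N}"] by auto
    then show "\<bar>measure \<mu> {x. \<forall>i\<in>B. act (\<gamma> B i) x \<in> A} - measure \<mu> A ^ card B\<bar> \<le> \<delta>"
      using L[of B "\<gamma> B"] far[OF \<open>B \<in> P\<close>] by (auto intro: less_imp_le)
  qed (auto simp: prob_space.prob_le_1[OF prob])
qed

text \<open>
  A compact set \<open>K\<close> outside \<^term>\<open>central_orbit_compacts act\<close> contains arbitrarily many points
  that are arbitrarily well separated.  A tuple of \<open>N\<close> of these is generic for a measure that gives
  the cube over the complement of a smaller ball a mass of about \<open>q\<^bsup>N\<^esup>\<close>, where \<open>q < 1\<close>.  Hence the translates by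
  most \<open>g\<close> move at least one of the \<open>N\<close> points into the ball.
\<close>

lemma density_missing_ball:
  fixes act :: "'g::{topological_group_add, t2_space, second_countable_topology} \<Rightarrow> 'x::polish_space \<Rightarrow> 'x"
  assumes act: "continuous_action act" and m: "left_haar_measure m" and F: "folner_sequence m F"
    and cpt: "compact (UNIV :: 'x set)"
    and \<mu>: "invariant_prob borel act \<mu>" and ue: "uniquely_ergodic act" and min: "minimal_action act"
    and mix: "mixing_of_all_orders act \<mu>"
    and msj: "minimal_self_joinings_of_all_orders act \<mu>"
    and no_pair: "\<not> (\<exists>x y. weakly_asymptotic_pair m F act x y)"
    and gen: "\<forall>N\<ge>1. \<forall>p \<in> {..<N} \<rightarrow>\<^sub>E UNIV.
           \<exists>\<nu>. ergodic_prob (power_borel {..<N}) (power_act {..<N} act) \<nu> \<and>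
               generic_point m F act N \<nu> p"
    and K: "K \<in> nonempty_compacts" "K \<notin> central_orbit_compacts act" and "r > 0"
  shows "(\<lambda>n. measure m (F n \<inter> {g. act g ` K \<inter> ball a r = {}}) / measure m (F n)) \<longlonglongrightarrow> 0"
proof (rule order_tendstoI)
  fix e :: real assume "e < 0"
  then show "eventually (\<lambda>n. e < measure m (F n \<inter> {g. act g ` K \<inter> ball a r = {}}) / measure m (F n)) sequentially"
    by (auto intro!: always_eventually less_le_trans[of e 0])
next
  fix e :: real assume "e > 0"
  interpret \<mu>: prob_space \<mu>
    using \<mu> by (simp add: invariant_prob_def)
  have sets: "sets \<mu> = sets borel"
    using \<mu> by (simp add: invariant_prob_def)
  have space: "space \<mu> = UNIV"
    using sets_eq_imp_space_eq[OF sets] by simp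
  define A where "A = - ball a (r / 2)"
  have A: "A \<in> sets borel"
    by (simp add: A_def)
  define q where "q = measure \<mu> A"
  have "measure \<mu> (ball a (r / 2)) > 0"
    using \<open>r > 0\<close> by (intro open_measure_pos[OF act \<mu> min cpt]) auto
  moreover have "q = 1 - measure \<mu> (ball a (r / 2))"
    unfolding q_def A_def using \<mu>.prob_compl[of "ball a (r / 2)"] by (simp add: sets space Compl_eq_Diff_UNIV)
  ultimately have q: "0 \<le> q" "q < 1"
    by (auto simp: q_def)
  obtain N0 where N0: "q ^ N0 < e / 4"
    using real_arch_pow_inv[of "e / 4" q] q \<open>e > 0\<close> by auto
  \<comment> \<open>Minimal self-joinings speak about powers with at least two factors.\<close>
  define N where "N = N0 + 2"
  have N: "N \<ge> 2" "q ^ N < e / 4"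
    using N0 power_decreasing[of N0 N q] q by (auto simp: N_def)
  define \<delta> where "\<delta> = e / (4 * real N)"
  have \<delta>: "\<delta> > 0" "real N * \<delta> = e / 4"
    using \<open>e > 0\<close> N by (auto simp: \<delta>_def)
  from mixing_block[OF act \<mu> mix A \<delta>(1), of N] obtain L where L: "compact L"
    and mixL: "\<And>B :: nat set. \<And>\<gamma>. finite B \<Longrightarrow> B \<noteq> {} \<Longrightarrow> card B \<le> N \<Longrightarrow>
      (\<forall>i\<in>B. \<forall>j\<in>B. i \<noteq> j \<longrightarrow> \<gamma> i - \<gamma> j \<notin> L) \<Longrightarrow>
      \<bar>measure \<mu> {x. \<forall>i\<in>B. act (\<gamma> i) x \<in> A} - measure \<mu> A ^ card B\<bar> < \<delta>"
    by blast
  \<comment> \<open>Negated, because a central \<open>z\<close> with \<open>\<gamma>\<^sub>j = z + \<gamma>\<^sub>i\<close> satisfies \<open>\<gamma>\<^sub>i - \<gamma>\<^sub>j = - z\<close>.\<close>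
  define C where "C = uminus ` L \<inter> group_center"
  have "compact C"
    unfolding C_def
    by (intro compact_Int_closed compact_continuous_image L closed_group_center continuous_intros)
  moreover have "C \<subseteq> group_center"
    by (auto simp: C_def)
  ultimately have "K \<in> spread_compacts act C N"
    using K not_central_orbit_compacts_iff[OF act K(1)] by blast
  then obtain S where S: "S \<subseteq> K" "finite S" "card S = N" "separated act C S"
    by (auto simp: spread_compacts_def)
  obtain x where "bij_betw x {0..<N} S"
    using ex_bij_betw_nat_finite[OF S(2)] S(3) by auto
  then have x: "bij_betw x {..<N} S"
    by (simp add: atLeast0LessThan)
  define p where "p = restrict x {..<N}"
  have "p \<in> {..<N} \<rightarrow>\<^sub>E UNIV"
    by (simp add: p_def)
  then obtain \<nu> where erg: "ergodic_prob (power_borel {..<N}) (power_act {..<N} act) \<nu>"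
    and gen\<nu>: "generic_point m F act N \<nu> p"
    using gen N(1) by (meson le_trans one_le_numeral)
  have "measure \<nu> ({..<N} \<rightarrow>\<^sub>E A) \<le> measure \<mu> A ^ N + real N * \<delta>"
  proof (rule generic_measure_PiE_le[OF act m F \<mu> ue msj no_pair erg gen\<nu> N(1) A _ mixL])
    fix i j z assume *: "i < N" "j < N" "i \<noteq> j" "z \<in> group_center" "- z \<in> L"
    then have "x i \<in> S" "x j \<in> S" "x i \<noteq> x j"
      using x by (auto simp: bij_betw_def inj_on_def)
    moreover have "z \<in> C"
      using * by (auto simp: C_def intro!: image_eqI[of _ _ "- z"])
    ultimately show "act z (p i) \<noteq> p j"
      using S(4) * by (simp add: p_def separated_def)
  qed
  then have \<nu>_small: "measure \<nu> ({..<N} \<rightarrow>\<^sub>E A) < e"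
    using N(2) \<delta> \<open>e > 0\<close> by (simp add: q_def)
  \<comment> \<open>A continuous function between the indicators of the complements of the two balls, since genericity
    is a statement about continuous functions only.\<close>
  define h where "h y = min 1 (max 0 (dist a y * 2 / r - 1))" for y
  have h_cont: "continuous_on UNIV h"
    unfolding h_def using \<open>r > 0\<close> by (intro continuous_intros) auto
  have h_bounds: "0 \<le> h y" "h y \<le> 1" for y
    by (auto simp: h_def)
  have h_out: "h y = 1" if "y \<notin> ball a r" for y
    using that \<open>r > 0\<close> by (simp add: h_def field_simps)
  have h_in: "h y = 0" if "y \<notin> A" for y
    using that \<open>r > 0\<close> by (simp add: h_def A_def field_simps)
  define f where "f p = (\<Prod>i<N. h (p i))" for p :: "nat \<Rightarrow> 'x"
  have f_bounds: "0 \<le> f p" "f p \<le> 1" for p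
    unfolding f_def using h_bounds by (auto intro: prod_nonneg prod_le_1)
  interpret \<nu>: prob_space \<nu>
    using erg by (simp add: ergodic_prob_def invariant_prob_def)
  have sets_\<nu>: "sets \<nu> = sets (power_borel {..<N})"
    using erg by (simp add: ergodic_prob_def invariant_prob_def)
  have "f \<in> borel_measurable (power_borel {..<N})"
    unfolding f_def
    by (intro borel_measurable_prod measurable_compose[OF _ borel_measurable_continuous_onI[OF h_cont]]
        measurable_component_singleton) auto
  then have f_meas: "f \<in> borel_measurable \<nu>"
    by (simp add: measurable_cong_sets[OF sets_\<nu> refl])
  have PiE_meas: "{..<N} \<rightarrow>\<^sub>E A \<in> sets \<nu>"
    unfolding sets_\<nu> using A by (intro sets_PiM_I_finite) auto
  have "(LINT q|\<nu>. f q) \<le> (LINT q|\<nu>. indicator ({..<N} \<rightarrow>\<^sub>E A) q)"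
  proof (rule integral_mono)
    show "integrable \<nu> f"
      using f_bounds f_meas by (intro \<nu>.integrable_const_bound[of _ 1]) auto
    show "integrable \<nu> (indicat_real ({..<N} \<rightarrow>\<^sub>E A))"
      using PiE_meas by (intro integrable_real_indicator) (auto simp: \<nu>.emeasure_eq_measure)
    fix y assume "y \<in> space \<nu>"
    then have ext: "y \<in> extensional {..<N}"
      using sets_eq_imp_space_eq[OF sets_\<nu>] by (auto simp: space_PiM PiE_def)
    show "f y \<le> indicator ({..<N} \<rightarrow>\<^sub>E A) y"
    proof (cases "y \<in> {..<N} \<rightarrow>\<^sub>E A")
      case False
      then obtain i where "i < N" "y i \<notin> A"
        using ext by (auto simp: PiE_iff)
      then have "f y = 0"
        unfolding f_def by (intro prod_zero) (auto intro!: bexI[of _ i] h_in)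
      then show ?thesis
        by simp
    qed (simp add: f_bounds)
  qed
  also have "\<dots> < e"
    using \<nu>_small PiE_meas by simp
  finally have f_small: "(LINT q|\<nu>. f q) < e" .
  have "continuous_map (product_topology (\<lambda>_. euclidean) {..<N}) euclideanreal f"
    unfolding f_def by (intro continuous_map_prod continuous_map_coordinate h_cont) auto
  then have "(\<lambda>n. (LINT g:F n|m. f (power_act {..<N} act g p)) / measure m (F n)) \<longlonglongrightarrow> (LINT q|\<nu>. f q)"
    using gen\<nu> by (simp add: generic_point_def)
  from order_tendstoD(2)[OF this f_small]
  have ev: "eventually (\<lambda>n. (LINT g:F n|m. f (power_act {..<N} act g p)) / measure m (F n) < e) sequentially" .
  have sets_m: "sets m = sets borel"
    using m by (simp add: left_haar_measure_def)
  define M where "M = {g. act g ` K \<inter> ball a r = {}}"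
  have M: "M \<in> sets borel"
  proof -
    have "open (\<Union>y\<in>K. (\<lambda>g. act g y) -` ball a r)"
      by (intro open_UN ballI open_vimage continuous_on_act[OF act] continuous_intros) auto
    moreover have "M = - (\<Union>y\<in>K. (\<lambda>g. act g y) -` ball a r)"
      by (auto simp: M_def)
    ultimately show ?thesis
      by (metis borel_comp borel_open)
  qed
  have le: "measure m (F n \<inter> M) \<le> (LINT g:F n|m. f (power_act {..<N} act g p))" for n
  proof -
    have Fn: "F n \<in> sets m" "emeasure m (F n) < \<infinity>"
      using F haar_finite_compact[OF m, of "F n"] by (auto simp: folner_sequence_def sets_m borel_compact)
    have FM: "F n \<inter> M \<in> fmeasurable m"
      by (rule fmeasurableI2[OF fmeasurableI[OF Fn]]) (use Fn M in \<open>auto simp: sets_m\<close>)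
    have "continuous_on UNIV (\<lambda>g. f (power_act {..<N} act g p))"
      unfolding f_def power_act_def
      by (auto intro!: continuous_on_prod continuous_on_compose2[OF h_cont] continuous_on_act[OF act] continuous_intros)
    then have meas: "(\<lambda>g. f (power_act {..<N} act g p)) \<in> borel_measurable m"
      using borel_measurable_continuous_onI by (auto simp: measurable_cong_sets[OF sets_m refl])
    have "measure m (F n \<inter> M) = (LINT g|m. indicator (F n \<inter> M) g)"
      using FM by simp
    also have "\<dots> \<le> (LINT g:F n|m. f (power_act {..<N} act g p))"
      unfolding set_lebesgue_integral_def
    proof (rule integral_mono)
      show "integrable m (indicat_real (F n \<inter> M))"
        using FM by (intro integrable_real_indicator) (auto simp: fmeasurable_def)
      show "integrable m (\<lambda>g. indicat_real (F n) g *\<^sub>R f (power_act {..<N} act g p))"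
        using f_bounds by (intro integrableI_bounded_set_indicator[where B = 1] Fn meas) auto
      fix g
      have "f (power_act {..<N} act g p) = 1" if "g \<in> M"
      proof -
        have "act g (x i) \<notin> ball a r" if "i < N" for i
          using \<open>g \<in> M\<close> x S(1) that unfolding M_def bij_betw_def by fastforce
        then show ?thesis
          by (simp add: f_def power_act_def p_def h_out)
      qed
      then show "indicat_real (F n \<inter> M) g \<le> indicat_real (F n) g *\<^sub>R f (power_act {..<N} act g p)"
        using f_bounds by (auto simp: indicator_def)
    qed
    finally show ?thesis .
  qed
  have "eventually (\<lambda>n. measure m (F n \<inter> M) / measure m (F n) < e) sequentially"
    using ev
  proof eventually_elim
    case (elim n)
    then show ?case
      using le[of n] F by (auto simp: folner_sequence_def intro: le_less_trans[OF divide_right_mono])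
  qed
  then show "eventually (\<lambda>n. measure m (F n \<inter> {g. act g ` K \<inter> ball a r = {}}) / measure m (F n) < e) sequentially"
    by (simp add: M_def)
qed

section \<open>Invariant measures on the hyperspace\<close>

text \<open>
  Joint measurability, as required for exchanging integrals.  By continuity of the action, \<open>g y \<in> V\<close>
  holds on a neighbourhood of \<open>(g, y)\<close>, and countable bases write the relation as a countable union
  of rectangles.
\<close>

lemma hitting_relation_measurable:
  fixes act :: "'g::{topological_group_add, t2_space, second_countable_topology} \<Rightarrow> 'x::polish_space \<Rightarrow> 'x"
  assumes act: "continuous_action act" and V: "open V"
  shows "{(g, K). K \<in> nonempty_compacts \<and> act g ` K \<inter> V \<noteq> {}} \<in> sets (borel \<Otimes>\<^sub>M hyperspace_borel)"
proof -
  obtain BG :: "'g set set" where BG: "countable BG" "topological_basis BG"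
    using ex_countable_basis by blast
  obtain BX :: "'x set set" where BX: "countable BX" "topological_basis BX"
    using ex_countable_basis by blast
  define I where "I = {(U, W). U \<in> BG \<and> W \<in> BX \<and> (\<forall>g\<in>U. \<forall>y\<in>W. act g y \<in> V)}"
  have "countable I"
    by (rule countable_subset[of _ "BG \<times> BX"]) (use BG BX in \<open>auto simp: I_def\<close>)
  have "{(g, K). K \<in> nonempty_compacts \<and> act g ` K \<inter> V \<noteq> {}} =
      (\<Union>(U, W)\<in>I. U \<times> {K \<in> nonempty_compacts. K \<inter> W \<noteq> {}})" (is "?L = ?R")
  proof (intro equalityI subsetI)
    fix a assume "a \<in> ?L"
    then obtain g K y where a: "a = (g, K)" "K \<in> nonempty_compacts" "y \<in> K" "act g y \<in> V"
      by auto
    define R where "R = (\<lambda>p. act (fst p) (snd p)) -` V"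
    have "open R"
      unfolding R_def by (intro open_vimage V continuous_on_act[OF act] continuous_intros)
    moreover have "(g, y) \<in> R"
      using a by (simp add: R_def)
    ultimately obtain U0 W0 where UW0: "open U0" "open W0" "g \<in> U0" "y \<in> W0" "U0 \<times> W0 \<subseteq> R"
      by (metis mem_Sigma_iff open_prod_elim)
    obtain U where U: "U \<in> BG" "g \<in> U" "U \<subseteq> U0"
      using topological_basisE[OF BG(2) UW0(1,3)] by blast
    obtain W where W: "W \<in> BX" "y \<in> W" "W \<subseteq> W0"
      using topological_basisE[OF BX(2) UW0(2,4)] by blast
    have "U \<times> W \<subseteq> R"
      using U W UW0(5) by blast
    then have "(U, W) \<in> I"
      using U W by (auto simp: I_def R_def subset_iff)
    then show "a \<in> ?R"
      using a U W by auto
  qed (auto simp: I_def)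
  moreover have "U \<times> {K \<in> nonempty_compacts. K \<inter> W \<noteq> {}} \<in> sets (borel \<Otimes>\<^sub>M hyperspace_borel)"
    if "(U, W) \<in> I" for U W
    using that topological_basis_open[OF BG(2)] topological_basis_open[OF BX(2)]
    by (intro pair_measureI hitting_set_measurable) (auto simp: I_def)
  then have "?R \<in> sets (borel \<Otimes>\<^sub>M hyperspace_borel)"
    using \<open>countable I\<close> by (intro sets.countable_UN'') auto
  ultimately show ?thesis
    by simp
qed

lemma image_noncentral_iff:
  fixes act :: "'g::{topological_group_add, t2_space} \<Rightarrow> 'x::metric_space \<Rightarrow> 'x"
  assumes act: "continuous_action act" and K: "K \<in> nonempty_compacts"
  shows "act g ` K \<in> nonempty_compacts - central_orbit_compacts act \<longleftrightarrow>
    K \<in> nonempty_compacts - central_orbit_compacts act"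
proof -
  have NC: "act g ` K \<in> nonempty_compacts" if "K \<in> nonempty_compacts" for g K
    using that by (intro image_mem_nonempty_compacts continuous_on_act[OF act] continuous_intros)
  have *: "act g ` K \<in> nonempty_compacts - central_orbit_compacts act"
    if K: "K \<in> nonempty_compacts - central_orbit_compacts act" for g K
  proof -
    have "K \<in> nonempty_compacts"
      using K by auto
    then show ?thesis
      using K NC[of K g] not_central_orbit_compacts_iff[OF act, of K]
        not_central_orbit_compacts_iff[OF act NC[of K g]] spread_compacts_image[OF act, of _ K _ g]
      by auto
  qed
  have "act (- g) ` act g ` K = K"
    by (simp add: image_image continuous_actionD(3)[OF act])
  with *[of "act g ` K" "- g"] *[of K g] show ?thesis
    by metis
qed

text \<open>
  Invariance of \<open>\<kappa>\<close> allows replacing the set by its translates and averaging over \<open>F n\<close>.  After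
  exchanging the integrals, the integrand at \<open>K\<close> is the density of those \<open>g \<in> F n\<close> for which \<open>g K\<close>
  misses \<open>V\<close>; it tends to \<open>0\<close>, and dominated convergence applies.
\<close>

lemma null_missing_open:
  fixes act :: "'g::{topological_group_add, t2_space, second_countable_topology} \<Rightarrow> 'x::polish_space \<Rightarrow> 'x"
  assumes act: "continuous_action act" and m: "left_haar_measure m" and F: "folner_sequence m F"
    and cpt: "compact (UNIV :: 'x set)" and V: "open V"
    and \<kappa>: "invariant_prob hyperspace_borel (\<lambda>g K. act g ` K) \<kappa>"
    and S: "S \<in> sets hyperspace_borel" "\<And>g K. K \<in> nonempty_compacts \<Longrightarrow> act g ` K \<in> S \<longleftrightarrow> K \<in> S"
    and lim: "\<And>K. K \<in> S \<Longrightarrow>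
      (\<lambda>n. measure m (F n \<inter> {g. act g ` K \<inter> V = {}}) / measure m (F n)) \<longlonglongrightarrow> 0"
  shows "{K \<in> S. K \<inter> V = {}} \<in> null_sets \<kappa>"
proof -
  interpret \<kappa>: prob_space \<kappa>
    using \<kappa> by (simp add: invariant_prob_def)
  have sets_\<kappa>: "sets \<kappa> = sets hyperspace_borel"
    using \<kappa> by (simp add: invariant_prob_def)
  have space_\<kappa>: "space \<kappa> = nonempty_compacts"
    using sets_eq_imp_space_eq[OF sets_\<kappa>] by simp
  have S_sub: "S \<subseteq> nonempty_compacts"
    using sets.sets_into_space[OF S(1)] by simp
  define E where "E = {K \<in> S. K \<inter> V = {}}"
  have "E = S - {K \<in> nonempty_compacts. K \<inter> V \<noteq> {}}"
    using S_sub by (auto simp: E_def)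
  then have E: "E \<in> sets hyperspace_borel"
    using S(1) hitting_set_measurable[OF V] by auto
  define W where "W = {(g, K). K \<in> S \<and> act g ` K \<inter> V = {}}"
  have "W = (UNIV \<times> S) - {(g, K). K \<in> nonempty_compacts \<and> act g ` K \<inter> V \<noteq> {}}"
    using S_sub by (auto simp: W_def)
  then have W: "W \<in> sets (borel \<Otimes>\<^sub>M hyperspace_borel)"
    using pair_measureI[of UNIV "borel :: 'g measure" S hyperspace_borel] S(1)
      hitting_relation_measurable[OF act V] by auto
  have sets_m: "sets m = sets borel"
    using m by (simp add: left_haar_measure_def)
  define u where "u n K = emeasure (uniform_measure m (F n)) ((\<lambda>g. (g, K)) -` W)" for n K
  have Fn: "emeasure m (F n) \<noteq> 0" "emeasure m (F n) \<noteq> \<infinity>" "F n \<in> sets m" for n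
  proof -
    have "compact (F n)" "measure m (F n) > 0"
      using F by (auto simp: folner_sequence_def)
    then show "emeasure m (F n) \<noteq> 0" "emeasure m (F n) \<noteq> \<infinity>" "F n \<in> sets m"
      using haar_finite_compact[OF m, of "F n"] by (auto simp: sets_m borel_compact measure_def)
  qed
  have U_prob: "prob_space (uniform_measure m (F n))" for n
    using Fn[of n] by (intro prob_space_uniform_measure) auto
  have Wn: "W \<in> sets (uniform_measure m (F n) \<Otimes>\<^sub>M \<kappa>)" for n
    using W sets_pair_measure_cong[of "uniform_measure m (F n)" borel \<kappa> hyperspace_borel] sets_m sets_\<kappa>
    by simp
  have slice: "emeasure \<kappa> (Pair g -` W) = emeasure \<kappa> E" for g
  proof -
    have T: "(\<lambda>K. act g ` K) \<in> measurable \<kappa> hyperspace_borel"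
      unfolding measurable_cong_sets[OF sets_\<kappa> refl]
      by (intro image_measurable_hyperspace continuous_on_act[OF act] continuous_intros cpt)
    have "Pair g -` W = (\<lambda>K. act g ` K) -` E \<inter> space \<kappa>"
      using S_sub S(2) by (auto simp: W_def E_def space_\<kappa>)
    also have "emeasure \<kappa> \<dots> = emeasure (distr \<kappa> hyperspace_borel (\<lambda>K. act g ` K)) E"
      by (rule emeasure_distr[OF T E, symmetric])
    also have "\<dots> = emeasure \<kappa> E"
      using \<kappa> by (simp add: invariant_prob_def)
    finally show ?thesis .
  qed
  have swap: "(\<integral>\<^sup>+K. u n K \<partial>\<kappa>) = emeasure \<kappa> E" for n
  proof -
    interpret U: prob_space "uniform_measure m (F n)"
      by (rule U_prob)
    interpret pair_sigma_finite "uniform_measure m (F n)" \<kappa> ..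
    have "(\<integral>\<^sup>+K. u n K \<partial>\<kappa>) = emeasure (uniform_measure m (F n) \<Otimes>\<^sub>M \<kappa>) W"
      unfolding u_def by (rule emeasure_pair_measure_alt2[OF Wn, symmetric])
    also have "\<dots> = (\<integral>\<^sup>+g. emeasure \<kappa> (Pair g -` W) \<partial>uniform_measure m (F n))"
      by (rule \<kappa>.emeasure_pair_measure_alt[OF Wn])
    also have "\<dots> = emeasure \<kappa> E"
      by (simp add: slice U.emeasure_space_1 del: space_uniform_measure)
    finally show ?thesis .
  qed
  have u_lim: "(\<lambda>n. u n K) \<longlonglongrightarrow> 0" for K
  proof (cases "K \<in> S")
    case True
    then have KW: "(\<lambda>g. (g, K)) -` W = {g. act g ` K \<inter> V = {}}"
      by (auto simp: W_def)
    have "(\<lambda>g. (g, K)) -` W \<in> sets borel"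
      by (rule sets_Pair2[OF W])
    then have "u n K = ennreal (measure m (F n \<inter> {g. act g ` K \<inter> V = {}}) / measure m (F n))" for n
      unfolding u_def KW finite_measure.emeasure_eq_measure[OF prob_space.axioms(1)[OF U_prob]] using Fn[of n]
      by (subst measure_uniform_measure) (auto simp: sets_m)
    then show ?thesis
      using tendsto_ennrealI[OF lim[OF True]] by simp
  next
    case False
    then have "(\<lambda>g. (g, K)) -` W = {}"
      by (auto simp: W_def)
    then show ?thesis
      by (simp add: u_def)
  qed
  have "(\<lambda>n. \<integral>\<^sup>+K. u n K \<partial>\<kappa>) \<longlonglongrightarrow> (\<integral>\<^sup>+K. 0 \<partial>\<kappa>)"
  proof (rule nn_integral_dominated_convergence[where w = "\<lambda>_. 1"])
    fix n
    interpret U: prob_space "uniform_measure m (F n)"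
      by (rule U_prob)
    interpret pair_sigma_finite "uniform_measure m (F n)" \<kappa> ..
    show "u n \<in> borel_measurable \<kappa>"
      unfolding u_def by (rule measurable_emeasure_Pair2[OF Wn])
    show "AE K in \<kappa>. u n K \<le> 1"
      unfolding u_def by (intro AE_I2 U.measure_le_1)
  qed (auto simp: u_lim \<kappa>.emeasure_space_1)
  then have "emeasure \<kappa> E = 0"
    by (simp add: swap LIMSEQ_const_iff)
  then show ?thesis
    using E by (simp add: null_sets_def sets_\<kappa> E_def)
qed

theorem theorem4:
  fixes m :: "'g::{topological_group_add, t2_space, second_countable_topology} measure"
    and act :: "'g \<Rightarrow> 'x::polish_space \<Rightarrow> 'x"
    and \<mu> :: "'x measure"
    and F :: "nat \<Rightarrow> 'g set"
  assumes "locally_compact_space (euclidean :: 'g topology)"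
    and "left_haar_measure m"
    and "amenable_group m"
    and "compact (UNIV :: 'x set)"
    and "continuous_action act"
    and "invariant_prob borel act \<mu>"
    and "folner_sequence m F"
    and "tempered m F"
    and "minimal_action act"
    and "uniquely_ergodic act"
    and "mixing_of_all_orders act \<mu>"
    and "minimal_self_joinings_of_all_orders act \<mu>"
    and "\<not> (\<exists>x y. weakly_asymptotic_pair m F act x y)"
    and "\<forall>N\<ge>1. \<forall>p \<in> {..<N} \<rightarrow>\<^sub>E UNIV.
           \<exists>\<nu>. ergodic_prob (power_borel {..<N}) (power_act {..<N} act) \<nu> \<and>
               generic_point m F act N \<nu> p"
  shows "ic_rigid act"
proof -
  note m = assms(2) and cpt = assms(4) and act = assms(5) and F = assms(7)
  define S where "S = nonempty_compacts - central_orbit_compacts act"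
  obtain C :: "nat \<Rightarrow> 'g set" where "(\<forall>k. compact (C k)) \<and> (\<forall>K. compact K \<longrightarrow> (\<exists>k. K \<subseteq> C k))"
    using compact_exhaustion[OF assms(1)] by blast
  then have C: "\<And>k. compact (C k)" "\<And>K. compact K \<Longrightarrow> \<exists>k. K \<subseteq> C k"
    by auto
  have "spread_compacts act (C k \<inter> group_center) n \<in> sets hyperspace_borel" for k n
    by (intro spread_compacts_measurable[OF act cpt] compact_Int_closed C closed_group_center)
  moreover have "S = (\<Inter>k. \<Inter>n. spread_compacts act (C k \<inter> group_center) n)"
    unfolding S_def by (rule not_central_orbit_compacts_eq[OF act]) (use C in auto)
  ultimately have S_meas: "S \<in> sets hyperspace_borel"
    by (simp add: sets.countable_INT'')
  obtain D :: "'x set" where "countable D \<and> (\<forall>U. open U \<longrightarrow> U \<noteq> {} \<longrightarrow> (\<exists>d\<in>D. d \<in> U))"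
    using countable_dense_exists by blast
  then have D: "countable D" "\<And>U. open U \<Longrightarrow> U \<noteq> {} \<Longrightarrow> \<exists>d\<in>D. d \<in> U"
    by auto
  \<comment> \<open>A compact set other than the whole space misses one of countably many balls.\<close>
  define Z where "Z = (\<Union>(a, k)\<in>D \<times> (UNIV :: nat set). {K \<in> S. K \<inter> ball a (1 / Suc k) = {}})"
  have Z: "S - {UNIV} = Z"
  proof (intro equalityI subsetI)
    fix K assume K: "K \<in> S - {UNIV}"
    then have "closed K"
      by (auto simp: S_def nonempty_compacts_def compact_imp_closed)
    moreover obtain y where "y \<notin> K"
      using K by auto
    ultimately obtain e where e: "e > 0" "ball y e \<subseteq> - K"
      by (metis ComplI open_Compl open_contains_ball)
    obtain a where a: "a \<in> D" "a \<in> ball y (e / 2)"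
      using D(2)[of "ball y (e / 2)"] e by auto
    obtain k where k: "1 / Suc k < e / 2"
      using nat_approx_posE[of "e / 2"] e by auto
    have "ball a (1 / Suc k) \<subseteq> ball y e"
    proof
      fix w assume "w \<in> ball a (1 / Suc k)"
      then show "w \<in> ball y e"
        using a k dist_triangle[of y w a] by simp
    qed
    then have "K \<inter> ball a (1 / Suc k) = {}"
      using e by blast
    then show "K \<in> Z"
      unfolding Z_def using K a by (intro UN_I[of "(a, k)"]) auto
  qed (auto simp: Z_def)
  have UNIV: "(UNIV :: 'x set) \<in> nonempty_compacts"
    using cpt by (simp add: nonempty_compacts_def)
  have eq: "central_orbit_compacts act \<union> {UNIV} = nonempty_compacts - Z"
    using central_orbit_compacts_subset[OF act] UNIV unfolding Z[symmetric] S_def by auto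
  show ?thesis
    unfolding ic_rigid_def
  proof (intro allI impI)
    fix \<kappa> assume \<kappa>: "invariant_prob hyperspace_borel (\<lambda>g K. act g ` K) \<kappa>"
    interpret prob_space \<kappa>
      using \<kappa> by (simp add: invariant_prob_def)
    have "space \<kappa> = nonempty_compacts"
      using \<kappa> sets_eq_imp_space_eq[of \<kappa> hyperspace_borel] by (simp add: invariant_prob_def)
    have "{K \<in> S. K \<inter> ball a (1 / Suc k) = {}} \<in> null_sets \<kappa>" for a and k :: nat
    proof (rule null_missing_open[OF act m F cpt open_ball \<kappa> S_meas])
      fix K assume "K \<in> S"
      then show "(\<lambda>n. measure m (F n \<inter> {g. act g ` K \<inter> ball a (1 / Suc k) = {}}) / measure m (F n)) \<longlonglongrightarrow> 0"
        by (intro density_missing_ball[OF act m F cpt assms(6,10,9,11-14)]) (auto simp: S_def)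
    qed (unfold S_def, rule image_noncentral_iff[OF act])
    then have "Z \<in> null_sets \<kappa>"
      unfolding Z_def using D(1) by (intro null_sets_UN') auto
    then have "prob (space \<kappa> - Z) = 1"
      by (subst prob_compl) (auto simp: null_sets_def measure_def)
    then show "prob (central_orbit_compacts act \<union> {UNIV}) = 1"
      unfolding eq \<open>space \<kappa> = nonempty_compacts\<close> .
  qed
qed

end
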